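(* Let $n\in\mathbb N_0$, let $\alpha,a,b,c,d\in\mathbb R$ or occur in complex conjugate pairs if complex, with $\max(|\alpha|,|a|,|b|,|c|,|d|)<1$, and let $0<|q|<1$, $|t|<(1-q)^3$. Then, with $x=\cos\theta$, $$\int_{-1}^1{}_2\phi_1\!\left(ae^{i\theta},be^{i\theta};ab;q,te^{-i\theta}\right)\,{}_2\phi_1\!\left(ce^{-i\theta},de^{-i\theta};cd;q,te^{i\theta}\right)p_n(x;\alpha,b,c,d|q)\frac{w(x;\alpha,b,c,d;q)}{\sqrt{1-x^2}}\,dx$$ $$=\frac{2\pi t^n(\alpha bcdq^{2n};q)_\infty\left(\pm\sqrt{abcd/q},\pm\sqrt{abcd};q\right)_n}{(q^{n+1},\alpha bq^n,\alpha cq^n,\alpha dq^n,bcq^n,bdq^n,cdq^n;q)_\infty(q,ab,cd,abcd/q;q)_n}$$ $$\times\;{}_4\phi_3\!\left(a/\alpha,bcq^n,bdq^n,abcdq^{2n-1};\ abq^n,abcdq^{n-1},\alpha bcdq^{2n};\ q,\alpha t\right).$$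
   Context: Notation: $\mathbb N_0=\{0,1,2,\dots\}$, $(a;q)_0=1$, $(a;q)_n=\prod_{j=0}^{n-1}(1-aq^j)$, $(a;q)_\infty=\prod_{j\ge0}(1-aq^j)$, $(a_1,\dots,a_r;q)_n=\prod_i(a_i;q)_n$ (also for $n=\infty$). In a list of parameters, $\pm a$ stands for the two entries $a,-a$. The basic hypergeometric series, with upper parameters listed before the first semicolon and lower parameters before the second, is $${}_r\phi_s(a_1,\dots,a_r;b_1,\dots,b_s;q,z)=\sum_{k=0}^\infty\frac{(a_1,\dots,a_r;q)_k}{(q,b_1,\dots,b_s;q)_k}\left((-1)^kq^{\binom k2}\right)^{1+s-r}z^k.$$ The Askey-Wilson polynomials are, for $x=\cos\theta$, $$p_n(x;a,b,c,d|q)=a^{-n}(ab,ac,ad;q)_n\,{}_4\phi_3\!\left(q^{-n},abcdq^{n-1},ae^{i\theta},ae^{-i\theta};\ ab,ac,ad;\ q,q\right),$$ and the weight function $w$ on $[-1,1]$ is $$w(x;a,b,c,d;q)=\left|\frac{(e^{2i\theta};q)_\infty}{(ae^{i\theta},be^{i\theta},ce^{i\theta},de^{i\theta};q)_\infty}\right|^2.$$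
   Formalization: The non-real numbers among α, b, c, d must form conjugate pairs among themselves (pairing one of them with a makes the identity false); also |t|<1, α≠0 and abcd≠q are assumed so that the series and quotients are defined; q is real. *)

theory Defs
  imports "HOL-Analysis.Analysis" "HOL-Library.Multiset"
begin

definition qpoch :: "complex \<Rightarrow> complex \<Rightarrow> nat \<Rightarrow> complex" where
  "qpoch a q n = (\<Prod>j<n. 1 - a * q ^ j)"

definition qpoch_inf :: "complex \<Rightarrow> complex \<Rightarrow> complex" where
  "qpoch_inf a q = (\<Prod>j. 1 - a * q ^ j)"

definition qpochs :: "complex list \<Rightarrow> complex \<Rightarrow> nat \<Rightarrow> complex" where
  "qpochs as q n = (\<Prod>a\<leftarrow>as. qpoch a q n)"

definition qpochs_inf :: "complex list \<Rightarrow> complex \<Rightarrow> complex" where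
  "qpochs_inf as q = (\<Prod>a\<leftarrow>as. qpoch_inf a q)"

definition basic_hyp :: "complex list \<Rightarrow> complex list \<Rightarrow> complex \<Rightarrow> complex \<Rightarrow> complex" where
  "basic_hyp as bs q z =
     (\<Sum>k. qpochs as q k / qpochs (q # bs) q k
        * ((-1) ^ k * q ^ (k choose 2)) powi (1 + int (length bs) - int (length as)) * z ^ k)"

text \<open>For \<open>x\<close> in \<open>[-1,1]\<close> the angle with \<open>x = cos \<theta>\<close> is taken as \<open>arccos x\<close>. The formula
  requires \<open>a \<noteq> 0\<close>.\<close>

definition askey_wilson_poly ::
  "nat \<Rightarrow> real \<Rightarrow> complex \<Rightarrow> complex \<Rightarrow> complex \<Rightarrow> complex \<Rightarrow> complex \<Rightarrow> complex" where
  "askey_wilson_poly n x a b c d q =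
     (let \<theta> = arccos x in
        a powi (- int n) * qpochs [a * b, a * c, a * d] q n
        * basic_hyp [q powi (- int n), a * b * c * d * q powi (int n - 1), a * cis \<theta>, a * cis (- \<theta>)]
            [a * b, a * c, a * d] q q)"

definition askey_wilson_weight ::
  "real \<Rightarrow> complex \<Rightarrow> complex \<Rightarrow> complex \<Rightarrow> complex \<Rightarrow> complex \<Rightarrow> real" where
  "askey_wilson_weight x a b c d q =
     (let \<theta> = arccos x in
        (cmod (qpoch_inf (cis (2 * \<theta>)) q
           / qpochs_inf [a * cis \<theta>, b * cis \<theta>, c * cis \<theta>, d * cis \<theta>] q))\<^sup>2)"

text \<open>Each entry is real or its conjugate occurs with the same multiplicity.\<close>

definition real_or_conj_pairs :: "complex multiset \<Rightarrow> bool" where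
  "real_or_conj_pairs M \<longleftrightarrow> image_mset cnj M = M"

end

theory Submission
  imports Defs "HOL-Complex_Analysis.Cauchy_Integral_Formula"
begin

text \<open>
  Write \<open>z = e\<^sup>i\<^sup>\<theta>\<close> and \<open>(x)\<^sub>k\<close> for the q-Pochhammer symbol. The product of the two \<open>\<^sub>2\<phi>\<^sub>1\<close> is the
  generating function of the Askey-Wilson polynomials with parameters \<open>a, b, c, d\<close>: the coefficient
  \<open>g\<^sub>m(z)\<close> of \<open>t\<^sup>m\<close> in it is \<open>p\<^sub>m(x; a, b, c, d) / ((q)\<^sub>m (ab)\<^sub>m (cd)\<^sub>m)\<close>. Hence the integral is the sum over
  \<open>m\<close> of \<open>t\<^sup>m\<close> times the integral of \<open>g\<^sub>m p\<^sub>n w\<close>, where \<open>p\<^sub>n\<close> and the weight \<open>w\<close> have parameters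
  \<open>\<alpha>, b, c, d\<close>, so that \<open>b, c, d\<close> are common to everything.

  These integrals have a closed form. The polynomial \<open>p\<^sub>n\<close> is by definition a sum of multiples of
  \<open>(\<alpha>z)\<^sub>j (\<alpha>/z)\<^sub>j\<close>, and Sears' transformation writes \<open>g\<^sub>m\<close> as a sum of multiples of \<open>(bz)\<^sub>k (b/z)\<^sub>k\<close>
  (\<open>aw_gf_coeff_conv_aw_phi\<close>). Multiplying \<open>w\<close> by these functions just shifts \<open>\<alpha>\<close> to \<open>\<alpha>q\<^sup>j\<close> and \<open>b\<close> to
  \<open>bq\<^sup>k\<close>, so every product integrates by the Askey-Wilson integral. The resulting double sum over \<open>j\<close>
  and \<open>k\<close> collapses by two uses of the q-Saalschuetz sum (\<open>aw_phi_product_integral\<close>). The inner sum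
  has the factor \<open>(q\<^sup>-\<^sup>k)\<^sub>n\<close>, which vanishes for \<open>k < n\<close>; this is the orthogonality and shows that only
  \<open>m \<ge> n\<close> contribute. The remaining sum over \<open>m = n + k\<close> is the \<open>\<^sub>4\<phi>\<^sub>3\<close> of the claim, term by term
  (\<open>aw_gf_integral_series\<close>). The expansion of \<open>g\<^sub>m\<close> divides by \<open>b\<close>, \<open>c\<close> and \<open>d\<close>, but the integral and
  its value depend continuously on these parameters, so zero parameters are covered by a limit.

  The Askey-Wilson integral itself (\<open>askey_wilson_integral\<close>) comes from a functional equation relating
  the parameters \<open>a\<close> and \<open>aq\<close>. It expresses that a certain function \<open>\<Phi>\<close>, holomorphic on an annulus
  around \<open>1 \<le> |z| \<le> 1/|q|\<close> and with \<open>\<Phi>(1/(qz)) = -\<Phi>(z)\<close>, has mean zero on the unit circle. Iterating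
  the functional equation moves all four parameters to zero, and the constant that remains is found
  from the parameters \<open>q, -q, \<surd>q, -\<surd>q\<close>, where the weight is elementary.
\<close>

section \<open>Finite and infinite q-Pochhammer symbols\<close>

lemma qpoch_0 [simp]: "qpoch a q 0 = 1"
  by (simp add: qpoch_def)

lemma qpoch_Suc: "qpoch a q (Suc n) = qpoch a q n * (1 - a * q ^ n)"
  by (simp add: qpoch_def)

lemma qpoch_add: "qpoch a q (m + n) = qpoch a q m * qpoch (a * q ^ m) q n"
  by (induction n) (simp_all add: qpoch_Suc power_add algebra_simps)

lemma qpoch_Suc': "qpoch a q (Suc n) = (1 - a) * qpoch (a * q) q n"
  using qpoch_add[of a q 1 n] by (simp add: qpoch_Suc)

lemma power_mult_neq_1:
  fixes a q :: complex
  assumes "norm a < 1" "norm q < 1"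
  shows "a * q ^ i \<noteq> 1"
proof
  assume "a * q ^ i = 1"
  then have "norm a * norm q ^ i = 1"
    by (metis norm_mult norm_power norm_one)
  moreover have "norm a * norm q ^ i \<le> norm a * 1"
    using assms by (intro mult_left_mono power_le_one) auto
  ultimately show False using assms by linarith
qed

lemma qpoch_nonzero:
  assumes "norm a < 1" "norm q < 1"
  shows "qpoch a q n \<noteq> 0"
  using power_mult_neq_1[OF assms] by (auto simp: qpoch_def)

lemma continuous_on_qpoch [continuous_intros]:
  "continuous_on S f \<Longrightarrow> continuous_on S (\<lambda>x. qpoch (f x) q n)"
  unfolding qpoch_def by (intro continuous_intros)

context
  fixes q :: complex
  assumes q1: "norm q < 1"
begin

lemma qpoch_inf_convergent: "convergent_prod (\<lambda>j. 1 - a * q ^ j)"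
proof -
  have "summable (\<lambda>j. norm a * norm q ^ j)"
    using q1 by (intro summable_mult summable_geometric) auto
  then have "summable (\<lambda>j. norm ((1 - a * q ^ j) - 1))"
    by (simp add: norm_mult norm_power)
  then show ?thesis
    using abs_convergent_prod_conv_summable abs_convergent_prod_imp_convergent_prod by blast
qed

lemma qpoch_inf_split: "qpoch_inf a q = qpoch a q n * qpoch_inf (a * q ^ n) q"
  using has_prod_ignore_initial_segment'[OF qpoch_inf_convergent[of a], of n]
  by (simp add: qpoch_inf_def qpoch_def has_prod_iff power_add mult_ac)

lemma qpoch_inf_Suc: "qpoch_inf a q = (1 - a) * qpoch_inf (a * q) q"
  using qpoch_inf_split[of a 1] by (simp add: qpoch_Suc)

lemma qpoch_inf_zero [simp]: "qpoch_inf 0 q = 1"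
  by (simp add: qpoch_inf_def)

lemma qpoch_LIMSEQ: "(\<lambda>n. qpoch a q n) \<longlonglongrightarrow> qpoch_inf a q"
proof -
  have "(\<lambda>n. \<Prod>i<n. 1 - a * q ^ i) \<longlonglongrightarrow> qpoch_inf a q"
    using convergent_prod_LIMSEQ[OF qpoch_inf_convergent[of a]]
    by (subst LIMSEQ_lessThan_iff_atMost) (simp_all add: qpoch_inf_def)
  then show ?thesis by (simp add: qpoch_def)
qed

lemma qpoch_inf_nonzero:
  assumes "norm a < 1"
  shows "qpoch_inf a q \<noteq> 0"
  unfolding qpoch_inf_def
  using power_mult_neq_1[OF assms q1] by (intro prodinf_nonzero qpoch_inf_convergent) auto

text \<open>By the Weierstrass M-test, since the factors differ from 1 by at most \<open>R |q|\<^sup>j\<close>. This makes the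
  infinite symbol an entire function of its base point.\<close>
lemma qpoch_uniform_limit:
  "uniform_limit (cball 0 R) (\<lambda>n a. qpoch a q n) (\<lambda>a. qpoch_inf a q) sequentially"
proof -
  have "uniformly_convergent_on (cball 0 R) (\<lambda>N a. \<Prod>n<N. 1 - a * q ^ n)"
  proof (rule uniformly_convergent_on_prod')
    show "uniformly_convergent_on (cball 0 R) (\<lambda>N a. \<Sum>n<N. norm (1 - a * q ^ n - 1))"
    proof (rule Weierstrass_m_test')
      show "summable (\<lambda>n. R * norm q ^ n)"
        using q1 by (intro summable_mult summable_geometric) auto
    qed (auto simp: norm_mult norm_power intro!: mult_right_mono)
  qed (auto intro!: continuous_intros)
  then obtain l where l: "uniform_limit (cball 0 R) (\<lambda>N a. \<Prod>n<N. 1 - a * q ^ n) l sequentially"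
    by (auto simp: uniformly_convergent_on_def)
  have "l a = qpoch_inf a q" if "a \<in> cball 0 R" for a
    using LIMSEQ_unique[OF tendsto_uniform_limitI[OF l that]] qpoch_LIMSEQ[of a]
    by (simp add: qpoch_def)
  with l show ?thesis
    unfolding qpoch_def by (subst uniform_limit_cong') auto
qed

lemma qpoch_inf_holomorphic: "(\<lambda>a. qpoch_inf a q) holomorphic_on UNIV"
proof (rule holomorphic_uniform_sequence)
  show "(\<lambda>a. qpoch a q n) holomorphic_on UNIV" for n
    unfolding qpoch_def by (intro holomorphic_intros)
  show "\<exists>d>0. cball x d \<subseteq> UNIV \<and> uniform_limit (cball x d) (\<lambda>n a. qpoch a q n) (\<lambda>a. qpoch_inf a q) sequentially"
    for x
  proof (intro exI[of _ 1] conjI)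
    have "cball x 1 \<subseteq> cball 0 (norm x + 1)"
      by (auto simp: dist_norm) (metis add.commute diff_add_cancel norm_minus_commute norm_triangle_le add_mono order_refl)
    then show "uniform_limit (cball x 1) (\<lambda>n a. qpoch a q n) (\<lambda>a. qpoch_inf a q) sequentially"
      by (rule uniform_limit_on_subset[OF qpoch_uniform_limit])
  qed auto
qed auto

lemma holomorphic_on_qpoch_inf [holomorphic_intros]:
  assumes "f holomorphic_on S"
  shows "(\<lambda>x. qpoch_inf (f x) q) holomorphic_on S"
  using holomorphic_on_compose_gen[OF assms qpoch_inf_holomorphic] by (simp add: o_def)

lemma continuous_on_qpoch_inf [continuous_intros]:
  assumes "continuous_on S f"
  shows "continuous_on S (\<lambda>x. qpoch_inf (f x) q)"
  using continuous_on_compose2[OF holomorphic_on_imp_continuous_on[OF qpoch_inf_holomorphic] assms]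
  by simp

end

section \<open>The q-Saalschuetz sum and Sears' transformation\<close>

context
  fixes q :: complex
  assumes q1: "norm q < 1"
begin

lemma qpoch_qq_nonzero [simp]: "qpoch q q n \<noteq> 0"
  using qpoch_nonzero[OF q1 q1] .

lemma one_minus_q_power_nonzero: "1 - q * q ^ i \<noteq> 0"
  using power_mult_neq_1[OF q1 q1, of i] by auto

text \<open>
  The q-Saalschuetz sum with all denominators that depend on \<open>A\<close>, \<open>B\<close>, \<open>D\<close> cleared. The proof is by
  creative telescoping: writing \<open>t n k\<close> for the summand, the difference
  \<open>t (n+1) k - (1 - ADq\<^sup>n)(1 - BDq\<^sup>n) t n k\<close> equals \<open>H k - H (k-1)\<close>, so that both sides satisfy the same
  first order recurrence in \<open>n\<close>.
\<close>
theorem q_saalschuetz_polynomial: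
  "(\<Sum>k\<le>n. qpoch q q n / (qpoch q q k * qpoch q q (n - k)) * qpoch A q k * qpoch B q k
      * qpoch D q (n - k) * D ^ k * qpoch (A * B * D * q ^ k) q (n - k))
   = qpoch (A * D) q n * qpoch (B * D) q n"
proof (induction n)
  case 0
  then show ?case by simp
next
  case (Suc n)
  define t where "t n k = qpoch q q n / (qpoch q q k * qpoch q q (n - k)) * qpoch A q k * qpoch B q k
      * qpoch D q (n - k) * D ^ k * qpoch (A * B * D * q ^ k) q (n - k)" for n k
  define P where "P = (1 - A * D * q ^ n) * (1 - B * D * q ^ n)"
  define H where "H k = - (q ^ (n - k)) * D * (1 - A * q ^ k) * (1 - B * q ^ k) * t n k" for k
  have step0: "t (Suc n) 0 = P * t n 0 + H 0"
  proof -
    define F where "F = qpoch D q n * qpoch (A * B * D) q n"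
    have eqs: "t (Suc n) 0 = F * ((1 - D * q ^ n) * (1 - A * B * D * q ^ n))" "t n 0 = F"
      "H 0 = - (q ^ n) * D * (1 - A) * (1 - B) * F"
      using one_minus_q_power_nonzero[of n] by (simp_all add: t_def H_def F_def qpoch_Suc)
    show ?thesis unfolding P_def eqs by algebra
  qed
  have step: "t (Suc n) (Suc j) = P * t n (Suc j) + H (Suc j) - H j" if "j < n" for j
  proof -
    from that obtain m where n: "n = Suc (j + m)"
      using less_iff_Suc_add by auto
    define y M where "y = q ^ j" and "M = q ^ m"
    define E where "E = qpoch q q n / (qpoch q q (Suc j) * qpoch q q (Suc m)) * qpoch A q (Suc j)
      * qpoch B q (Suc j) * qpoch D q m * D ^ Suc j * qpoch (A * B * D * q ^ Suc j) q m"
    note nz = one_minus_q_power_nonzero[of j] one_minus_q_power_nonzero[of m]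
    have t1: "t (Suc n) (Suc j) = E * ((1 - q * q ^ n) * (1 - D * M) * (1 - A * B * D * q * y * M))"
      by (simp add: t_def E_def n qpoch_Suc[of _ _ m] qpoch_Suc[of q q "Suc (j + m)"] Suc_diff_le
          power_add y_def M_def mult_ac)
    have t2: "t n (Suc j) = E * (1 - q * M)"
      using nz by (simp add: t_def E_def n qpoch_Suc[of q q m] M_def field_simps)
    have H1: "H (Suc j) = - M * D * (1 - A * q * y) * (1 - B * q * y) * t n (Suc j)"
      by (simp add: H_def n M_def y_def mult_ac)
    have "qpoch (A * B * D * q ^ j) q (Suc m)
        = (1 - A * B * D * y) * qpoch (A * B * D * q ^ Suc j) q m"
      by (simp add: qpoch_Suc' y_def mult_ac)
    then have tj: "t n j = qpoch q q n / (qpoch q q j * qpoch q q (Suc m)) * qpoch A q j * qpoch B q j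
        * (qpoch D q m * (1 - D * M)) * D ^ j
        * ((1 - A * B * D * y) * qpoch (A * B * D * q ^ Suc j) q m)"
      by (simp add: t_def n Suc_diff_le qpoch_Suc[of D] M_def)
    have E1: "E * (1 - q * y) = qpoch q q n / (qpoch q q j * qpoch q q (Suc m))
        * (qpoch A q j * (1 - A * y)) * (qpoch B q j * (1 - B * y)) * qpoch D q m * (D * D ^ j)
        * qpoch (A * B * D * q ^ Suc j) q m"
      using nz(1) by (simp add: E_def qpoch_Suc[of _ _ j] y_def)
    have "n - j = Suc m" by (simp add: n)
    then have "H j = - (q * M) * D * (1 - A * y) * (1 - B * y) * t n j"
      by (simp add: H_def M_def y_def)
    then have H2: "H j = - q * M * (E * (1 - q * y)) * ((1 - D * M) * (1 - A * B * D * y))"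
      unfolding E1 tj by simp
    have qn: "q ^ n = q * y * M" by (simp add: n y_def M_def power_add mult_ac)
    show ?thesis
      unfolding H1 H2 unfolding t1 t2 P_def qn by algebra
  qed
  have "(\<Sum>k\<le>Suc n. t (Suc n) k) = t (Suc n) 0 + (\<Sum>j<n. t (Suc n) (Suc j)) + t (Suc n) (Suc n)"
    by (simp add: sum.atMost_shift)
  also have "(\<Sum>j<n. t (Suc n) (Suc j)) = (\<Sum>j<n. P * t n (Suc j) + (H (Suc j) - H j))"
    by (intro sum.cong) (simp_all add: step)
  also have "\<dots> = P * (\<Sum>j<n. t n (Suc j)) + (H n - H 0)"
    by (simp add: sum.distrib sum_distrib_left sum_lessThan_telescope)
  also have "t (Suc n) (Suc n) = - H n"
    using one_minus_q_power_nonzero[of n] by (simp add: t_def H_def qpoch_Suc)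
  finally have "(\<Sum>k\<le>Suc n. t (Suc n) k) = P * (t n 0 + (\<Sum>j<n. t n (Suc j)))"
    by (simp add: step0 algebra_simps)
  also have "t n 0 + (\<Sum>j<n. t n (Suc j)) = (\<Sum>k\<le>n. t n k)"
    by (simp add: sum.atMost_shift)
  also have "\<dots> = qpoch (A * D) q n * qpoch (B * D) q n"
    unfolding t_def by (rule Suc.IH)
  finally show ?case
    unfolding t_def P_def by (simp add: qpoch_Suc mult_ac)
qed

context
  assumes q0: "q \<noteq> 0"
begin

lemma qpoch_negative_power:
  assumes "k \<le> n"
  shows "qpoch (1 / q ^ n) q k = (\<Prod>i<k. - (q ^ i / q ^ n)) * qpoch q q n / qpoch q q (n - k)"
  using assms
proof (induction k)
  case (Suc k)
  then obtain m where n: "n = Suc (k + m)" using less_iff_Suc_add Suc_le_eq by metis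
  have "1 - 1 / q ^ n * q ^ k = - (q ^ k / q ^ n) * (1 - q * q ^ m)"
    using q0 by (simp add: n power_add field_simps)
  then have "qpoch (1 / q ^ n) q (Suc k) = (\<Prod>i<k. - (q ^ i / q ^ n)) * qpoch q q n / qpoch q q (n - k)
      * (- (q ^ k / q ^ n) * (1 - q * q ^ m))"
    using Suc by (simp add: qpoch_Suc)
  moreover have "qpoch q q (n - k) = qpoch q q (n - Suc k) * (1 - q * q ^ m)"
    by (simp add: n Suc_diff_le qpoch_Suc)
  ultimately show ?case
    using one_minus_q_power_nonzero[of m] by (simp add: mult_ac)
qed simp

text \<open>Reading the factors of a finite symbol in reverse order replaces the base point by a multiple of
  its inverse; this moves between the symbols \<open>(q\<^sup>1\<^sup>-\<^sup>n/x)\<^sub>d\<close> and \<open>(x)\<^sub>d\<close> in the sums below.\<close>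
lemma qpoch_reversal:
  assumes "x \<noteq> 0"
  shows "qpoch (q / (x * q ^ (k + d))) q d * (\<Prod>i<d. - (x * q ^ (k + i))) = qpoch (x * q ^ k) q d"
proof (induction d)
  case (Suc d)
  have "q / (x * q ^ (k + Suc d)) * q = q / (x * q ^ (k + d))"
    using q0 by (simp add: field_simps)
  then have "qpoch (q / (x * q ^ (k + Suc d))) q (Suc d)
     = (1 - 1 / (x * q ^ (k + d))) * qpoch (q / (x * q ^ (k + d))) q d"
    using q0 by (simp add: qpoch_Suc')
  then have "qpoch (q / (x * q ^ (k + Suc d))) q (Suc d) * (\<Prod>i<Suc d. - (x * q ^ (k + i)))
     = (1 - 1 / (x * q ^ (k + d))) * (- (x * q ^ (k + d))) * qpoch (x * q ^ k) q d"
    by (simp add: Suc[symmetric] mult_ac)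
  also have "(1 - 1 / (x * q ^ (k + d))) * (- (x * q ^ (k + d))) = 1 - x * q ^ k * q ^ d"
    using q0 assms by (simp add: field_simps power_add)
  finally show ?case by (simp add: qpoch_Suc mult_ac)
qed simp

text \<open>
  The classical balanced \<open>\<^sub>3\<phi>\<^sub>2\<close> form, with lower parameters written as \<open>Au\<close> and \<open>Av\<close>; the hypothesis
  on \<open>B\<close> says that the series is balanced. It is the polynomial form with \<open>D = q\<^sup>1\<^sup>-\<^sup>n/(Av)\<close> after reversing
  the symbols that involve \<open>D\<close>. In this parametrisation the value factors through \<open>u\<close> and \<open>v\<close>, which
  are the ratios that occur in all later applications.
\<close>
theorem q_saalschuetz:
  assumes B: "B * q = A * u * v * q ^ n" and "A \<noteq> 0" "v \<noteq> 0"
    and nz: "qpoch (A * u) q n \<noteq> 0" "qpoch (A * v) q n \<noteq> 0"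
  shows "(\<Sum>k\<le>n. qpoch (1 / q ^ n) q k * qpoch A q k * qpoch B q k * q ^ k
             / (qpoch q q k * qpoch (A * u) q k * qpoch (A * v) q k))
         = A ^ n * qpoch u q n * qpoch v q n / (qpoch (A * u) q n * qpoch (A * v) q n)"
proof -
  define D where "D = q / (A * v * q ^ n)"
  have Av: "A * v \<noteq> 0" using assms by simp
  have AD: "A * D = q / (v * q ^ n)" using assms by (simp add: D_def)
  have BD: "B * D = u" using assms q0 by (simp add: D_def)
  have ABD: "A * B * D = A * u" using BD by (simp add: mult.assoc)
  define \<rho> where "\<rho> = (\<Prod>i<n. - (A * v * q ^ i))"
  have \<rho>: "\<rho> = A ^ n * (\<Prod>i<n. - (v * q ^ i))"
  proof -
    have "(\<Prod>i<r. - (A * v * q ^ i)) = A ^ r * (\<Prod>i<r. - (v * q ^ i))" for r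
      by (induction r) (simp_all add: mult_ac)
    then show ?thesis unfolding \<rho>_def .
  qed
  have main: "\<rho> * (qpoch (A * D) q n * qpoch (B * D) q n) = A ^ n * qpoch u q n * qpoch v q n"
    using qpoch_reversal[OF \<open>v \<noteq> 0\<close>, of 0 n] by (simp add: \<rho> AD BD mult_ac)
  have trm: "\<rho> * (qpoch q q n / (qpoch q q k * qpoch q q (n - k)) * qpoch A q k * qpoch B q k
      * qpoch D q (n - k) * D ^ k * qpoch (A * B * D * q ^ k) q (n - k))
    = qpoch (1 / q ^ n) q k * qpoch A q k * qpoch B q k * q ^ k
             / (qpoch q q k * qpoch (A * u) q k * qpoch (A * v) q k)
       * (qpoch (A * u) q n * qpoch (A * v) q n)" if "k \<le> n" for k
  proof -
    have n: "n = k + (n - k)" using that by simp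
    have s1: "qpoch (A * u) q n = qpoch (A * u) q k * qpoch (A * u * q ^ k) q (n - k)"
      by (subst n, rule qpoch_add)
    have s2: "qpoch (A * v) q n = qpoch (A * v) q k * qpoch (A * v * q ^ k) q (n - k)"
      by (subst n, rule qpoch_add)
    have s3: "qpoch (A * v * q ^ k) q (n - k) = qpoch D q (n - k) * (\<Prod>i<n-k. - (A * v * q ^ (k + i)))"
      using qpoch_reversal[OF Av, of k "n - k"] that by (simp add: D_def)
    have s4: "\<rho> = (\<Prod>i<k. - (A * v * q ^ i)) * (\<Prod>i<n-k. - (A * v * q ^ (k + i)))"
    proof -
      have "(\<Prod>i<k + r. - (A * v * q ^ i)) = (\<Prod>i<k. - (A * v * q ^ i)) * (\<Prod>i<r. - (A * v * q ^ (k + i)))" for r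
        by (induction r) (simp_all add: mult_ac)
      from this[of "n - k"] show ?thesis unfolding \<rho>_def using that by simp
    qed
    have s5: "D ^ k * (\<Prod>i<k. - (A * v * q ^ i)) = (\<Prod>i<k. - (q ^ i / q ^ n)) * q ^ k"
    proof (induction k)
      case (Suc k)
      have "D ^ Suc k * (\<Prod>i<Suc k. - (A * v * q ^ i)) = (D ^ k * (\<Prod>i<k. - (A * v * q ^ i))) * (- D * A * v * q ^ k)"
        by (simp add: mult_ac)
      also have "- D * A * v * q ^ k = - (q ^ k / q ^ n) * q"
        using assms q0 by (simp add: D_def field_simps)
      finally show ?case unfolding Suc by (simp add: mult_ac)
    qed simp
    have nk: "qpoch (A * u) q k \<noteq> 0" "qpoch (A * v) q k \<noteq> 0"
      using nz s1 s2 by auto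
    define X where "X = (\<Prod>i<n-k. - (A * v * q ^ (k + i)))"
    define R where "R = qpoch q q n / (qpoch q q k * qpoch q q (n - k)) * qpoch A q k * qpoch B q k
      * qpoch D q (n - k) * qpoch (A * u * q ^ k) q (n - k) * X"
    have "\<rho> * (qpoch q q n / (qpoch q q k * qpoch q q (n - k)) * qpoch A q k * qpoch B q k
      * qpoch D q (n - k) * D ^ k * qpoch (A * B * D * q ^ k) q (n - k))
      = (D ^ k * (\<Prod>i<k. - (A * v * q ^ i))) * R"
      unfolding s4 ABD R_def X_def by (simp add: mult_ac)
    also have "\<dots> = (\<Prod>i<k. - (q ^ i / q ^ n)) * q ^ k * R"
      unfolding s5 ..
    also have "\<dots> = qpoch (1 / q ^ n) q k * qpoch A q k * qpoch B q k * q ^ k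
             / (qpoch q q k * qpoch (A * u) q k * qpoch (A * v) q k)
       * (qpoch (A * u) q n * qpoch (A * v) q n)"
      unfolding s1 s2 s3 qpoch_negative_power[OF that] R_def X_def[symmetric] using nk by (simp add: mult_ac)
    finally show ?thesis .
  qed
  have "(\<Sum>k\<le>n. qpoch (1 / q ^ n) q k * qpoch A q k * qpoch B q k * q ^ k
             / (qpoch q q k * qpoch (A * u) q k * qpoch (A * v) q k)
       * (qpoch (A * u) q n * qpoch (A * v) q n)) = A ^ n * qpoch u q n * qpoch v q n"
    unfolding main[symmetric] q_saalschuetz_polynomial[symmetric] sum_distrib_left
    by (intro sum.cong) (simp_all only: trm atMost_iff)
  then show ?thesis
    using nz unfolding sum_distrib_right[symmetric] by (simp add: nonzero_eq_divide_eq)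
qed

lemma sum_triangle_swap:
  "(\<Sum>k\<le>n. \<Sum>i\<le>k. g i (k - i)) = (\<Sum>i\<le>n. \<Sum>l\<le>n - i. g i l)" for n :: nat
proof -
  have "{(i, j). i + j \<le> n} = (SIGMA i:{..n}. {..n - i})" by auto
  then show ?thesis
    unfolding sum.triangle_reindex_eq[symmetric] by (simp add: sum.Sigma)
qed

text \<open>
  The left-hand side is a terminating balanced \<open>\<^sub>4\<phi>\<^sub>3\<close> with \<open>z\<close> in several lower parameters, and the right-hand side
  is one whose only dependence on \<open>z\<close> is through \<open>(bz)\<^sub>k (b/z)\<^sub>k\<close>. To pass from right to left,
  the polynomial q-Saalschuetz sum expands \<open>(b/z)\<^sub>k (abcdq\<^sup>m\<^sup>-\<^sup>1)\<^sub>k\<close> as a sum over \<open>i \<le> k\<close>; after exchanging the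
  two summations, the sum over \<open>k\<close> is again a balanced \<open>\<^sub>3\<phi>\<^sub>2\<close>.
\<close>
theorem sears_transformation:
  assumes "z \<noteq> 0" "b \<noteq> 0" "c \<noteq> 0" "d \<noteq> 0"
    and nz: "qpoch (a * b) q m \<noteq> 0" "qpoch (b * c) q m \<noteq> 0" "qpoch (b * d) q m \<noteq> 0"
      "qpoch (c * d) q m \<noteq> 0"
  shows "(\<Sum>i\<le>m. qpoch (a * z) q i * qpoch (b * z) q i / (qpoch q q i * qpoch (a * b) q i) * (1 / z) ^ i
           * (qpoch (c / z) q (m - i) * qpoch (d / z) q (m - i)
              / (qpoch q q (m - i) * qpoch (c * d) q (m - i)) * z ^ (m - i)))
     = qpoch (b * c) q m * qpoch (b * d) q m / (b ^ m * qpoch q q m * qpoch (c * d) q m)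
       * (\<Sum>k\<le>m. qpoch (1 / q ^ m) q k * qpoch (a * b * c * d * q ^ m / q) q k
            * qpoch (b * z) q k * qpoch (b / z) q k * q ^ k
            / (qpoch q q k * qpoch (a * b) q k * qpoch (b * c) q k * qpoch (b * d) q k))"
proof -
  define B where "B = q / (c * d * q ^ m)"
  define E where "E = b * c * d * q ^ m / (z * q)"
  define T where "T i l = qpoch (1 / q ^ m) q (i + l) * qpoch (b * z) q (i + l) * q ^ (i + l)
      * qpoch (a * z) q i * qpoch B q i * qpoch E q l * E ^ i
      / (qpoch (b * c) q (i + l) * qpoch (b * d) q (i + l) * qpoch q q i * qpoch q q l
         * qpoch (a * b) q i)" for i l
  have split: "qpoch x q k = qpoch x q i * qpoch (x * q ^ i) q (k - i)" if "i \<le> k" for x i k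
    using qpoch_add[of x q i "k - i"] that by simp
  have nzk: "qpoch x q k \<noteq> 0" if "qpoch x q m \<noteq> 0" "k \<le> m" for x k
    using split[of k m x] that by auto
  have 1: "qpoch (1 / q ^ m) q k * qpoch (a * b * c * d * q ^ m / q) q k
            * qpoch (b * z) q k * qpoch (b / z) q k * q ^ k
            / (qpoch q q k * qpoch (a * b) q k * qpoch (b * c) q k * qpoch (b * d) q k)
      = (\<Sum>i\<le>k. T i (k - i))" if "k \<le> m" for k
  proof -
    have e: "a * z * E = a * b * c * d * q ^ m / q" "B * E = b / z" "a * z * B * E = a * b"
      using assms q0 by (simp_all add: E_def B_def field_simps)
    have "qpoch (a * b * c * d * q ^ m / q) q k * qpoch (b / z) q k
      = (\<Sum>i\<le>k. qpoch q q k / (qpoch q q i * qpoch q q (k - i)) * qpoch (a * z) q i * qpoch B q i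
      * qpoch E q (k - i) * E ^ i * qpoch (a * b * q ^ i) q (k - i))"
      using q_saalschuetz_polynomial[of k "a * z" B E] unfolding e by simp
    also have "\<dots> = (\<Sum>i\<le>k. qpoch q q k / (qpoch q q i * qpoch q q (k - i)) * qpoch (a * z) q i * qpoch B q i
      * qpoch E q (k - i) * E ^ i * qpoch (a * b) q k / qpoch (a * b) q i)"
      using nzk[OF nz(1)] that by (intro sum.cong refl) (simp add: split[of _ k "a * b"])
    finally have f: "qpoch (a * b * c * d * q ^ m / q) q k * qpoch (b / z) q k = \<dots>" .
    have "qpoch (1 / q ^ m) q k * qpoch (a * b * c * d * q ^ m / q) q k
            * qpoch (b * z) q k * qpoch (b / z) q k * q ^ k
            / (qpoch q q k * qpoch (a * b) q k * qpoch (b * c) q k * qpoch (b * d) q k)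
       = (qpoch (a * b * c * d * q ^ m / q) q k * qpoch (b / z) q k) * (qpoch (1 / q ^ m) q k *
            qpoch (b * z) q k * q ^ k
            / (qpoch q q k * qpoch (a * b) q k * qpoch (b * c) q k * qpoch (b * d) q k))"
      by simp
    also have "\<dots> = (\<Sum>i\<le>k. T i (k - i))"
      unfolding f sum_distrib_right using nzk[OF nz(1) that]
      by (intro sum.cong refl) (simp add: T_def mult_ac)
    finally show ?thesis .
  qed
  have 2: "(\<Sum>l\<le>m - i. T i l) = qpoch (1 / q ^ m) q i * qpoch (b * z) q i * q ^ i
      * qpoch (a * z) q i * qpoch B q i * E ^ i / (qpoch q q i * qpoch (a * b) q i)
      * ((b * z * q ^ i) ^ (m - i) * qpoch (c / z) q (m - i) * qpoch (d / z) q (m - i)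
         / (qpoch (b * c) q m * qpoch (b * d) q m))" if "i \<le> m" for i
  proof -
    have u: "b * z * q ^ i * (c / z) = b * c * q ^ i" "b * z * q ^ i * (d / z) = b * d * q ^ i"
      using assms by auto
    have im: "1 / q ^ m * q ^ i = 1 / q ^ (m - i)"
      using that q0 by (simp add: power_diff)
    have Eq: "E * q = b * z * q ^ i * (c / z) * (d / z) * q ^ (m - i)"
      using assms q0 that by (simp add: E_def power_diff field_simps)
    have nn: "qpoch (b * c * q ^ i) q (m - i) \<noteq> 0" "qpoch (b * d * q ^ i) q (m - i) \<noteq> 0"
      using nz that by (auto simp: split[of i m])
    have "(\<Sum>l\<le>m - i. T i l) = qpoch (1 / q ^ m) q i * qpoch (b * z) q i * q ^ i
      * qpoch (a * z) q i * qpoch B q i * E ^ i / (qpoch q q i * qpoch (a * b) q i * qpoch (b * c) q i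
      * qpoch (b * d) q i) * (\<Sum>l\<le>m - i. qpoch (1 / q ^ (m - i)) q l * qpoch (b * z * q ^ i) q l
         * qpoch E q l * q ^ l / (qpoch q q l * qpoch (b * z * q ^ i * (c / z)) q l
           * qpoch (b * z * q ^ i * (d / z)) q l))"
      unfolding sum_distrib_left u im[symmetric]
      by (intro sum.cong refl) (simp add: T_def qpoch_add power_add mult_ac)
    also have "(\<Sum>l\<le>m - i. qpoch (1 / q ^ (m - i)) q l * qpoch (b * z * q ^ i) q l
         * qpoch E q l * q ^ l / (qpoch q q l * qpoch (b * z * q ^ i * (c / z)) q l
           * qpoch (b * z * q ^ i * (d / z)) q l))
      = (b * z * q ^ i) ^ (m - i) * qpoch (c / z) q (m - i) * qpoch (d / z) q (m - i)
         / (qpoch (b * z * q ^ i * (c / z)) q (m - i) * qpoch (b * z * q ^ i * (d / z)) q (m - i))"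
      using assms q0 nn by (intro q_saalschuetz Eq) (simp_all only: u mult_eq_0_iff power_eq_0_iff divide_eq_0_iff simp_thms)
    finally show ?thesis
      unfolding u using that by (simp add: split[of i m "b * c"] split[of i m "b * d"])
  qed
  have 3: "qpoch (1 / q ^ m) q i * q ^ i * qpoch B q i * E ^ i * (b * z * q ^ i) ^ (m - i)
        / (b ^ m * qpoch q q m * qpoch (c * d) q m)
      = (1 / z) ^ i * z ^ (m - i) / (qpoch q q (m - i) * qpoch (c * d) q (m - i))" if "i \<le> m" for i
  proof -
    define \<rho> where "\<rho> = (\<Prod>r<i. - (c * d * q ^ (m - i + r)))"
    have \<rho>0: "\<rho> \<noteq> 0" using assms q0 by (simp add: \<rho>_def)
    have cd: "qpoch (c * d * q ^ (m - i)) q i = qpoch B q i * \<rho>"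
      using qpoch_reversal[of "c * d" "m - i" i] assms that by (simp add: B_def \<rho>_def)
    have "qpoch (c * d) q m = qpoch (c * d) q (m - i) * qpoch (c * d * q ^ (m - i)) q i"
      using split[of "m - i" m "c * d"] that by simp
    then have cdm: "qpoch (c * d) q m = qpoch (c * d) q (m - i) * qpoch B q i * \<rho>"
      by (simp add: cd)
    have nn: "qpoch (c * d) q (m - i) \<noteq> 0" "qpoch B q i \<noteq> 0"
      using nz(4) cdm by auto
    have sgn: "(\<Prod>r<i. - (q ^ r / q ^ m)) * (c * d * q ^ m * q ^ (m - i)) ^ i = \<rho>"
    proof -
      have "(\<Prod>r<i. - (q ^ r / q ^ m)) * (c * d * q ^ m * q ^ (m - i)) ^ i
        = (\<Prod>r<i. - (q ^ r / q ^ m) * (c * d * q ^ m * q ^ (m - i)))"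
        by (subst prod.distrib) simp
      also have "\<dots> = \<rho>"
        unfolding \<rho>_def using q0 by (intro prod.cong refl) (simp add: power_add field_simps)
      finally show ?thesis .
    qed
    have "E * q * z = b * c * d * q ^ m" using assms q0 by (simp add: E_def)
    then have "(E * q * z) ^ i * (q ^ (m - i)) ^ i = b ^ i * (c * d * q ^ m * q ^ (m - i)) ^ i"
      by (simp add: power_mult_distrib mult_ac)
    then have pw: "E ^ i * q ^ i * (q ^ i) ^ (m - i) * z ^ i = b ^ i * (c * d * q ^ m * q ^ (m - i)) ^ i"
      by (simp add: power_mult_distrib mult_ac flip: power_mult)
    have bm: "b ^ m = b ^ i * b ^ (m - i)" using that by (simp flip: power_add)
    have "qpoch (1 / q ^ m) q i * q ^ i * qpoch B q i * E ^ i * (b * z * q ^ i) ^ (m - i)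
        / (b ^ m * qpoch q q m * qpoch (c * d) q m)
      = (\<Prod>r<i. - (q ^ r / q ^ m)) * (E ^ i * q ^ i * (q ^ i) ^ (m - i) * z ^ i) * (1 / z) ^ i * z ^ (m - i)
        / (b ^ i * \<rho> * qpoch q q (m - i) * qpoch (c * d) q (m - i))"
      unfolding qpoch_negative_power[OF that] cdm bm using nn assms
      by (simp add: field_simps power_mult_distrib)
    also have "\<dots> = ((\<Prod>r<i. - (q ^ r / q ^ m)) * (c * d * q ^ m * q ^ (m - i)) ^ i) * (1 / z) ^ i * z ^ (m - i)
        / (\<rho> * qpoch q q (m - i) * qpoch (c * d) q (m - i))"
      unfolding pw using assms by (simp add: mult_ac)
    also have "\<dots> = (1 / z) ^ i * z ^ (m - i) / (qpoch q q (m - i) * qpoch (c * d) q (m - i))"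
      unfolding sgn using \<rho>0 by simp
    finally show ?thesis .
  qed
  let ?K = "qpoch (b * c) q m * qpoch (b * d) q m / (b ^ m * qpoch q q m * qpoch (c * d) q m)"
  have "?K * (\<Sum>k\<le>m. qpoch (1 / q ^ m) q k * qpoch (a * b * c * d * q ^ m / q) q k
            * qpoch (b * z) q k * qpoch (b / z) q k * q ^ k
            / (qpoch q q k * qpoch (a * b) q k * qpoch (b * c) q k * qpoch (b * d) q k))
     = ?K * (\<Sum>i\<le>m. \<Sum>l\<le>m - i. T i l)"
    unfolding sum_triangle_swap[symmetric] by (simp add: 1)
  also have "\<dots> = (\<Sum>i\<le>m. qpoch (a * z) q i * qpoch (b * z) q i / (qpoch q q i * qpoch (a * b) q i)
     * qpoch (c / z) q (m - i) * qpoch (d / z) q (m - i) * (qpoch (1 / q ^ m) q i * q ^ i * qpoch B q i * E ^ i * (b * z * q ^ i) ^ (m - i)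
        / (b ^ m * qpoch q q m * qpoch (c * d) q m)))"
    using nz by (subst sum_distrib_left, intro sum.cong refl) (simp add: 2 mult_ac)
  also have "\<dots> = (\<Sum>i\<le>m. qpoch (a * z) q i * qpoch (b * z) q i / (qpoch q q i * qpoch (a * b) q i) * (1 / z) ^ i
           * (qpoch (c / z) q (m - i) * qpoch (d / z) q (m - i)
              / (qpoch q q (m - i) * qpoch (c * d) q (m - i)) * z ^ (m - i)))"
    by (intro sum.cong refl) (simp add: 3)
  finally show ?thesis by simp
qed

end
end

section \<open>A functional equation for the mean of the Askey-Wilson kernel\<close>

text \<open>The weight function in a form that is analytic in \<open>z\<close> and in the parameters. On the unit
  circle it is the squared modulus when \<open>q\<close> is real and conjugation permutes the parameters.\<close>
definition aw_kernel :: "complex \<Rightarrow> complex \<Rightarrow> complex \<Rightarrow> complex \<Rightarrow> complex \<Rightarrow> complex \<Rightarrow> complex" where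
  "aw_kernel q a b c d z = qpoch_inf (z\<^sup>2) q * qpoch_inf (1 / z\<^sup>2) q
     / (\<Prod>x\<leftarrow>[a, b, c, d]. qpoch_inf (x * z) q * qpoch_inf (x / z) q)"

lemma aw_kernel_inverse: "aw_kernel q a b c d (1 / z) = aw_kernel q a b c d z"
  by (simp add: aw_kernel_def power_one_over mult_ac)

lemma aw_kernel_commute:
  "aw_kernel q a b c d = aw_kernel q b a c d" "aw_kernel q a b c d = aw_kernel q a c b d"
  "aw_kernel q a b c d = aw_kernel q a b d c"
  by (simp_all add: aw_kernel_def fun_eq_iff mult_ac)

definition circle_mean :: "(complex \<Rightarrow> complex) \<Rightarrow> complex" where
  "circle_mean f = integral {0..1} (\<lambda>t. f (cis (2 * pi * t)))"

lemma circle_mean_has_integral: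
  assumes "continuous_on (sphere 0 1) f"
  shows "((\<lambda>t. f (cis (2 * pi * t))) has_integral circle_mean f) {0..1}"
  unfolding circle_mean_def
  by (intro integrable_integral integrable_continuous_real continuous_on_compose2[OF assms] continuous_intros) auto

lemma circle_mean_cong:
  assumes "\<And>z. norm z = 1 \<Longrightarrow> f z = g z"
  shows "circle_mean f = circle_mean g"
  unfolding circle_mean_def by (intro integral_cong assms) auto

lemma circle_mean_linear:
  assumes "continuous_on (sphere 0 1) f" "continuous_on (sphere 0 1) g"
  shows "circle_mean (\<lambda>z. x * f z + y * g z) = x * circle_mean f + y * circle_mean g"
  unfolding circle_mean_def[of "\<lambda>z. x * f z + y * g z"]
  using assms by (intro integral_unique has_integral_add has_integral_mult_right circle_mean_has_integral)

lemma circle_mean_inverse: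
  assumes "continuous_on (sphere 0 1) f"
  shows "circle_mean (\<lambda>z. f (1 / z)) = circle_mean f"
proof -
  have "((\<lambda>t. f (cis (2 * pi * ((-1) *\<^sub>R t + 1)))) has_integral (1 / \<bar>-1\<bar> ^ DIM(real)) *\<^sub>R circle_mean f)
     ((\<lambda>x. (1 / (-1)) *\<^sub>R x + - ((1 / (-1)) *\<^sub>R 1)) ` cbox 0 1)"
    using circle_mean_has_integral[OF assms] by (intro has_integral_affinity) auto
  moreover have "(\<lambda>x. (1 / (-1)) *\<^sub>R x + - ((1 / (-1)) *\<^sub>R 1)) ` cbox 0 (1::real) = {0..1}"
    using image_affinity_atLeastAtMost[of "-1" 1 0 "1::real"] by (simp add: algebra_simps)
  moreover have "cis (2 * pi * ((-1) *\<^sub>R t + 1)) = 1 / cis (2 * pi * t)" for t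
  proof -
    have "2 * pi * ((-1) *\<^sub>R t + 1) = 2 * pi - 2 * pi * t" by (simp add: algebra_simps)
    then show ?thesis by (simp add: cis_divide[symmetric])
  qed
  ultimately show ?thesis
    unfolding circle_mean_def[of "\<lambda>z. f (1 / z)"] by (intro integral_unique) simp
qed

lemma has_integral_half_circle:
  assumes f: "continuous_on (sphere 0 1) f" and even: "\<And>z. norm z = 1 \<Longrightarrow> f (1 / z) = f z"
  shows "((\<lambda>\<theta>. f (cis \<theta>)) has_integral pi * circle_mean f) {0..pi}"
proof -
  define I where "I = integral {0..pi} (\<lambda>\<theta>. f (cis \<theta>))"
  have I: "((\<lambda>\<theta>. f (cis \<theta>)) has_integral I) (cbox 0 pi)"
    unfolding I_def box_real
    by (intro integrable_integral integrable_continuous_real continuous_on_compose2[OF f] continuous_intros) auto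
  have "((\<lambda>t. f (cis (2 * pi * t))) has_integral I /\<^sub>R (2 * pi)) {0..1/2}"
  proof -
    have "(\<lambda>x. (1 / (2 * pi)) *\<^sub>R x + - ((1 / (2 * pi)) *\<^sub>R 0)) ` cbox 0 pi = {0..1/2}"
      using image_affinity_atLeastAtMost[of "1 / (2 * pi)" 0 0 pi] by simp
    with has_integral_affinity[OF I, of "2 * pi" 0] show ?thesis
      by (simp add: field_simps)
  qed
  moreover have "((\<lambda>t. f (cis (2 * pi * t))) has_integral I /\<^sub>R (2 * pi)) {1/2..1}"
  proof -
    have "(\<lambda>x. (1 / (- 2 * pi)) *\<^sub>R x + - ((1 / (- 2 * pi)) *\<^sub>R (2 * pi))) ` cbox 0 pi = {1/2..1}"
      using image_affinity_atLeastAtMost[of "- 1 / (2 * pi)" 1 0 pi] pi_gt_zero by (simp del: pi_gt_zero add: linorder_not_le[symmetric])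
    moreover have "f (cis ((- 2 * pi) *\<^sub>R t + 2 * pi)) = f (cis (2 * pi * t))" for t
    proof -
      have "cis ((- 2 * pi) *\<^sub>R t + 2 * pi) = 1 / cis (2 * pi * t)"
      proof -
        have "(- 2 * pi) *\<^sub>R t + 2 * pi = 2 * pi - 2 * pi * t" by simp
        then show ?thesis by (simp add: cis_divide[symmetric])
      qed
      then show ?thesis using even[of "cis (2 * pi * t)"] by simp
    qed
    ultimately show ?thesis
      using has_integral_affinity[OF I, of "- 2 * pi" "2 * pi"] by (simp add: field_simps)
  qed
  ultimately have "((\<lambda>t. f (cis (2 * pi * t))) has_integral I /\<^sub>R (2 * pi) + I /\<^sub>R (2 * pi)) {0..1}"
    by (intro has_integral_combine[of 0 "1/2"]) auto
  then have "circle_mean f = I /\<^sub>R (2 * pi) + I /\<^sub>R (2 * pi)"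
    unfolding circle_mean_def by (rule integral_unique)
  then have "of_real pi * circle_mean f = I"
    by (simp add: scaleR_conv_of_real field_simps)
  with I show ?thesis by simp
qed

context
  fixes q :: complex
  assumes q1: "norm q < 1"
begin

lemma continuous_on_aw_kernel:
  assumes "continuous_on S a" "continuous_on S b" "continuous_on S c" "continuous_on S d"
    "continuous_on S z"
    and "\<And>x. x \<in> S \<Longrightarrow> norm (a x) < 1 \<and> norm (b x) < 1 \<and> norm (c x) < 1 \<and> norm (d x) < 1 \<and> norm (z x) = 1"
  shows "continuous_on S (\<lambda>x. aw_kernel q (a x) (b x) (c x) (d x) (z x))"
proof -
  have "z x \<noteq> 0" if "x \<in> S" for x using assms(6)[OF that] by auto
  moreover have "qpoch_inf (y * z x) q \<noteq> 0 \<and> qpoch_inf (y / z x) q \<noteq> 0" if "x \<in> S" "norm y < 1" for x y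
    using assms(6)[OF that(1)] that(2)
    by (intro conjI qpoch_inf_nonzero q1) (simp_all add: norm_mult norm_divide)
  ultimately show ?thesis
    unfolding aw_kernel_def using assms
    by (auto intro!: continuous_intros continuous_on_qpoch_inf[OF q1])
qed

text \<open>
  The circles \<open>|z| = 1\<close> and \<open>|z| = 1/|q|\<close> are homotopic in the annulus, so \<open>\<Phi>(z)\<close> and \<open>\<Phi>(z/q)\<close> have
  the same mean. Antisymmetry turns \<open>\<Phi>(z/q)\<close> into \<open>-\<Phi>(1/z)\<close>, whose mean is minus that of \<open>\<Phi>\<close>.
\<close>
lemma circle_mean_antisymmetric:
  assumes q0: "q \<noteq> 0" and m: "0 \<le> m" "m < 1"
    and hol: "\<Phi> holomorphic_on {z. m < norm z \<and> m * norm q * norm z < 1}"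
    and anti: "\<And>z. z \<noteq> 0 \<Longrightarrow> \<Phi> (1 / (q * z)) = - \<Phi> z"
  shows "circle_mean \<Phi> = 0"
proof -
  define S where "S = {z :: complex. m < norm z \<and> m * norm q * norm z < 1}"
  have S: "open S" unfolding S_def by (intro open_Collect_conj open_Collect_less continuous_intros)
  have S0: "z \<noteq> 0" if "z \<in> S" for z using that m by (auto simp: S_def)
  have circ: "sphere 0 1 \<subseteq> S"
    using m q1 mult_strict_mono[of m 1 "norm q" 1] by (auto simp: S_def)
  have cont: "continuous_on (sphere 0 1) \<Phi>"
    using continuous_on_subset[OF holomorphic_on_imp_continuous_on[OF hol]] circ unfolding S_def .
  define f where "f z = \<Phi> z / z" for z
  have f: "f holomorphic_on S"
    unfolding f_def using hol S0 by (intro holomorphic_intros) (auto simp: S_def)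
  define e where "e t = exp (2 * of_real pi * \<i> * of_real t)" for t
  have e: "e t = cis (2 * pi * t)" for t
    by (simp add: e_def cis_conv_exp mult_ac)
  have ed: "((\<lambda>t. e t * x) has_vector_derivative 2 * of_real pi * \<i> * e t * x) (at t)" for t x
    unfolding e_def
    by (rule has_vector_derivative_real_field[of "\<lambda>w. exp (2 * of_real pi * \<i> * w) * x"])
       (auto intro!: derivative_eq_intros)
  define p where "p x t = e t * x" for x t
  have vd: "vector_derivative (p x) (at t) = 2 * of_real pi * \<i> * e t * x" for x t
    unfolding p_def using ed by (rule vector_derivative_at)
  have vp: "valid_path (p x)" for x
  proof -
    have "p x = (\<lambda>z. z * x) \<circ> circlepath 0 1"
      by (auto simp: p_def e_def circlepath)
    moreover have "valid_path ((\<lambda>z. z * x) \<circ> circlepath 0 1)"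
      by (rule valid_path_compose_holomorphic[of _ _ UNIV]) (auto intro!: holomorphic_intros)
    ultimately show ?thesis by simp
  qed
  have hom: "homotopic_loops S (p 1) (p (1 / q))"
    unfolding homotopic_loops
  proof (intro exI conjI ballI funcsetI)
    \<comment> \<open>A straight-line homotopy would pass through 0 for negative \<open>q\<close>, so the circle is rotated
      while it is scaled.\<close>
    let ?h = "\<lambda>(s, t). exp (2 * of_real pi * \<i> * of_real t - of_real s * Ln q)"
    show "continuous_on ({0..1} \<times> {0..1}) ?h"
      unfolding case_prod_unfold by (intro continuous_intros)
    fix t :: real
    show "?h (0, t) = p 1 t" by (simp add: p_def e_def)
    show "?h (1, t) = p (1 / q) t" using q0 by (simp add: p_def e_def exp_diff)
    show "pathfinish (?h \<circ> Pair t) = pathstart (?h \<circ> Pair t)"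
      by (simp add: pathfinish_def pathstart_def exp_diff)
  next
    let ?h = "\<lambda>(s, t). exp (2 * of_real pi * \<i> * of_real t - of_real s * Ln q)"
    fix st :: "real \<times> real" assume "st \<in> {0..1} \<times> {0..1}"
    then obtain s t where st: "st = (s, t)" "0 \<le> s" "s \<le> 1" by auto
    have l: "ln (norm q) < 0" using q0 q1 by simp
    have nh: "norm (?h st) = exp (- s * ln (norm q))"
      using q0 by (simp add: st norm_exp_eq_Re)
    have "s * ln (norm q) \<le> 0" using l st by (simp add: mult_nonneg_nonpos)
    then have n1: "norm (?h st) \<ge> 1" unfolding nh by simp
    have "(1 - s) * ln (norm q) \<le> 0" using l st by (intro mult_nonneg_nonpos) auto
    moreover have "norm q * norm (?h st) = exp ((1 - s) * ln (norm q))"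
    proof -
      have "(1 - s) * ln (norm q) = ln (norm q) + - s * ln (norm q)" by (simp add: left_diff_distrib)
      then show ?thesis unfolding nh using q0 by (simp only: exp_add) simp
    qed
    ultimately have n2: "norm q * norm (?h st) \<le> 1" by simp
    have "m * (norm q * norm (?h st)) \<le> m * 1" using n2 m by (intro mult_left_mono)
    then have "m * norm q * norm (?h st) < 1" using m by (simp add: mult.assoc)
    then show "?h st \<in> S" using n1 m by (simp add: S_def)
  qed
  have ci: "contour_integral (p x) f = 2 * of_real pi * \<i> * integral {0..1} (\<lambda>t. \<Phi> (e t * x))"
    if "x \<noteq> 0" for x
  proof -
    have "contour_integral (p x) f = integral {0..1} (\<lambda>t. 2 * of_real pi * \<i> * \<Phi> (e t * x))"
      unfolding contour_integral_integral vd using that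
      by (intro integral_cong) (simp add: f_def p_def e)
    then show ?thesis by simp
  qed
  have "integral {0..1} (\<lambda>t. \<Phi> (e t * 1)) = integral {0..1} (\<lambda>t. \<Phi> (e t * (1 / q)))"
    using Cauchy_theorem_homotopic_loops[OF hom S f vp vp] q0 by (simp add: ci)
  also have "\<dots> = integral {0..1} (\<lambda>t. - \<Phi> (1 / e t))"
  proof (intro integral_cong)
    fix t
    show "\<Phi> (e t * (1 / q)) = - \<Phi> (1 / e t)"
      using anti[of "1 / e t"] by (simp add: e)
  qed
  also have "\<dots> = - circle_mean (\<lambda>z. \<Phi> (1 / z))"
    by (simp add: circle_mean_def e)
  finally have "circle_mean \<Phi> = - circle_mean \<Phi>"
    unfolding circle_mean_inverse[OF cont] by (simp add: circle_mean_def e)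
  then show ?thesis by simp
qed

text \<open>
  With \<open>W\<close> for the kernel and \<open>u(z) = (1-az)(1-bz)(1-cz)(1-dz) / (z (1-z\<^sup>2))\<close>, the function \<open>\<Phi> = W u\<close> is
  antisymmetric under \<open>z \<mapsto> 1/(qz)\<close> and has mean zero. Now \<open>u(z) + u(1/z)\<close> is
  \<open>L = (1 - e\<^sub>4)(z + 1/z) - (e\<^sub>1 - e\<^sub>3)\<close> in terms of the elementary symmetric functions \<open>e\<^sub>i\<close> of the
  parameters, so \<open>W L\<close> has mean zero too. The kernel with \<open>aq\<close> in place of \<open>a\<close> is
  \<open>W (1 - az)(1 - a/z)\<close>, and \<open>(1 - e\<^sub>4)(1 - az)(1 - a/z)\<close> differs from the constant
  \<open>(1 - ab)(1 - ac)(1 - ad)\<close> by \<open>-aL\<close>.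
\<close>
lemma aw_mean_recurrence:
  assumes q0: "q \<noteq> 0" and n: "norm a < 1" "norm b < 1" "norm c < 1" "norm d < 1"
  shows "(1 - a * b) * (1 - a * c) * (1 - a * d) * circle_mean (aw_kernel q a b c d)
     = (1 - a * b * c * d) * circle_mean (aw_kernel q (a * q) b c d)"
proof -
  define \<Phi> where "\<Phi> z = qpoch_inf (q * z\<^sup>2) q * qpoch_inf (1 / z\<^sup>2) q
     / (z * (\<Prod>x\<leftarrow>[a, b, c, d]. qpoch_inf (x * q * z) q * qpoch_inf (x / z) q))" for z
  define m where "m = Max {norm a, norm b, norm c, norm d}"
  have m: "0 \<le> m" "m < 1" "norm a \<le> m" "norm b \<le> m" "norm c \<le> m" "norm d \<le> m"
    using n by (auto simp: m_def le_max_iff_disj)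
  let ?S = "{z :: complex. m < norm z \<and> m * norm q * norm z < 1}"
  have nz: "qpoch_inf (x * q * z) q \<noteq> 0 \<and> qpoch_inf (x / z) q \<noteq> 0" if "z \<in> ?S" "norm x \<le> m" for x z
  proof (intro conjI qpoch_inf_nonzero q1)
    have "norm x * (norm q * norm z) \<le> m * (norm q * norm z)" using that by (intro mult_right_mono) auto
    then show "norm (x * q * z) < 1" using that by (simp add: norm_mult mult.assoc)
    show "norm (x / z) < 1" using that m by (auto simp: norm_divide divide_simps)
  qed
  have hol: "\<Phi> holomorphic_on ?S"
    unfolding \<Phi>_def using nz m by (auto intro!: holomorphic_intros holomorphic_on_qpoch_inf[OF q1])
  have anti: "\<Phi> (1 / (q * z)) = - \<Phi> z" if z: "z \<noteq> 0" for z
  proof -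
    have 1: "qpoch_inf (q * z\<^sup>2) q = (1 - q * z\<^sup>2) * qpoch_inf (q\<^sup>2 * z\<^sup>2) q"
      using qpoch_inf_Suc[OF q1, of "q * z\<^sup>2"] by (simp add: power2_eq_square mult_ac)
    have 2: "qpoch_inf (1 / (q * z\<^sup>2)) q = (1 - 1 / (q * z\<^sup>2)) * qpoch_inf (1 / z\<^sup>2) q"
      using qpoch_inf_Suc[OF q1, of "1 / (q * z\<^sup>2)"] q0 by simp
    have 3: "q * (1 / (q * z))\<^sup>2 = 1 / (q * z\<^sup>2)" "1 / (1 / (q * z))\<^sup>2 = q\<^sup>2 * z\<^sup>2"
      "x * q * (1 / (q * z)) = x / z" "x / (1 / (q * z)) = x * q * z" for x
      using q0 by (simp_all add: power2_eq_square)
    have "(1 - 1 / (q * z\<^sup>2)) * (q * z) = - ((1 - q * z\<^sup>2) / z)"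
      using z q0 by (simp add: field_simps power2_eq_square)
    moreover define R where "R = qpoch_inf (1 / z\<^sup>2) q * qpoch_inf (q\<^sup>2 * z\<^sup>2) q
       / (\<Prod>x\<leftarrow>[a, b, c, d]. qpoch_inf (x * q * z) q * qpoch_inf (x / z) q)"
    moreover have "\<Phi> (1 / (q * z)) = (1 - 1 / (q * z\<^sup>2)) * (q * z) * R"
      unfolding \<Phi>_def 3 unfolding 2 R_def by (simp add: mult_ac)
    moreover have "\<Phi> z = (1 - q * z\<^sup>2) / z * R"
      unfolding \<Phi>_def 1 R_def by simp
    ultimately show ?thesis by simp
  qed
  have mean0: "circle_mean \<Phi> = 0"
    by (rule circle_mean_antisymmetric[OF q0 m(1,2) hol anti])
  have circ: "sphere 0 1 \<subseteq> ?S"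
    using m q1 mult_strict_mono[of m 1 "norm q" 1] by auto
  have cont: "continuous_on (sphere 0 1) \<Phi>"
    using continuous_on_subset[OF holomorphic_on_imp_continuous_on[OF hol] circ] .
  then have cont': "continuous_on (sphere 0 1) (\<lambda>z. \<Phi> (1 / z))"
    by (rule continuous_on_compose2) (auto intro!: continuous_intros simp: norm_divide)
  have contW: "continuous_on (sphere 0 1) (aw_kernel q a b c d)"
    using n by (intro continuous_on_aw_kernel) (auto intro!: continuous_intros)
  have key: "(1 - a * b * c * d) * aw_kernel q (a * q) b c d z
     = (1 - a * b) * (1 - a * c) * (1 - a * d) * aw_kernel q a b c d z + (- a) * (1 * \<Phi> z + 1 * \<Phi> (1 / z))"
    if z: "norm z = 1" for z
  proof -
    define w where "w = 1 / z"
    have z0: "z \<noteq> 0" using z by auto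
    have zw: "z * w = 1" using z0 by (simp add: w_def)
    have nw: "norm w = 1" using z by (simp add: w_def norm_divide)
    have z2: "1 / z\<^sup>2 = w\<^sup>2" "1 / w\<^sup>2 = z\<^sup>2" "x / z = x * w" "x / w = x * z" for x
      by (simp_all add: w_def power_one_over)
    have nx: "1 - x * z \<noteq> 0" "1 - x * w \<noteq> 0" if "norm x < 1" for x
    proof -
      have "norm (x * z) < 1" "norm (x * w) < 1" using that z nw by (simp_all add: norm_mult)
      then have "x * z \<noteq> 1" "x * w \<noteq> 1" by auto
      then show "1 - x * z \<noteq> 0" "1 - x * w \<noteq> 0" by auto
    qed
    define R where "R = qpoch_inf (q * z\<^sup>2) q * qpoch_inf (q * w\<^sup>2) q
       / (\<Prod>x\<leftarrow>[a, b, c, d]. qpoch_inf (x * q * z) q * qpoch_inf (x * q * w) q)"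
    define Q where "Q = R / ((1 - a * z) * (1 - a * w) * (1 - b * z) * (1 - b * w)
       * (1 - c * z) * (1 - c * w) * (1 - d * z) * (1 - d * w))"
    have s: "qpoch_inf (z\<^sup>2) q = (1 - z\<^sup>2) * qpoch_inf (q * z\<^sup>2) q"
      "qpoch_inf (w\<^sup>2) q = (1 - w\<^sup>2) * qpoch_inf (q * w\<^sup>2) q"
      "qpoch_inf (x * z) q = (1 - x * z) * qpoch_inf (x * q * z) q"
      "qpoch_inf (x * w) q = (1 - x * w) * qpoch_inf (x * q * w) q" for x
      using qpoch_inf_Suc[OF q1, of "z\<^sup>2"] qpoch_inf_Suc[OF q1, of "w\<^sup>2"]
        qpoch_inf_Suc[OF q1, of "x * z"] qpoch_inf_Suc[OF q1, of "x * w"] by (simp_all add: mult_ac)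
    have W: "aw_kernel q a b c d z = (1 - z\<^sup>2) * (1 - w\<^sup>2) * Q"
      unfolding aw_kernel_def z2 list.map s(1,2) s(3)[of a] s(3)[of b] s(3)[of c] s(3)[of d]
        s(4)[of a] s(4)[of b] s(4)[of c] s(4)[of d] by (simp add: Q_def R_def mult_ac)
    have "aw_kernel q (a * q) b c d z
        = (1 - z\<^sup>2) * (1 - w\<^sup>2) * (R / ((1 - b * z) * (1 - b * w) * (1 - c * z) * (1 - c * w) * (1 - d * z) * (1 - d * w)))"
      unfolding aw_kernel_def z2 list.map prod_list.Cons
      unfolding s(1,2) s(3)[of b] s(4)[of b] s(3)[of c] s(4)[of c] s(3)[of d] s(4)[of d]
      by (simp add: R_def mult_ac)
    also have "\<dots> = (1 - a * z) * (1 - a * w) * (1 - z\<^sup>2) * (1 - w\<^sup>2) * Q"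
      using nx[OF n(1)] by (simp add: Q_def mult_ac)
    finally have Wq: "aw_kernel q (a * q) b c d z = \<dots>" .
    have "\<Phi> z = (1 - w\<^sup>2) * w * (R / ((1 - a * w) * (1 - b * w) * (1 - c * w) * (1 - d * w)))"
      unfolding \<Phi>_def z2 list.map s(2) s(4)[of a] s(4)[of b] s(4)[of c] s(4)[of d] by (simp add: R_def w_def mult_ac)
    also have "\<dots> = (1 - w\<^sup>2) * w * ((1 - a * z) * (1 - b * z) * (1 - c * z) * (1 - d * z)) * Q"
      using nx[OF n(1)] nx[OF n(2)] nx[OF n(3)] nx[OF n(4)] by (simp add: Q_def mult_ac)
    finally have P1: "\<Phi> z = \<dots>" .
    have "\<Phi> w = (1 - z\<^sup>2) * z * (R / ((1 - a * z) * (1 - b * z) * (1 - c * z) * (1 - d * z)))"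
      unfolding \<Phi>_def z2 list.map s(1) s(3)[of a] s(3)[of b] s(3)[of c] s(3)[of d] by (simp add: R_def w_def mult_ac)
    also have "\<dots> = (1 - z\<^sup>2) * z * ((1 - a * w) * (1 - b * w) * (1 - c * w) * (1 - d * w)) * Q"
      using nx[OF n(1)] nx[OF n(2)] nx[OF n(3)] nx[OF n(4)] by (simp add: Q_def mult_ac)
    finally have P2: "\<Phi> w = \<dots>" .
    define e1 e2 e3 e4 where "e1 = a + b + c + d" and "e2 = a*b + a*c + a*d + b*c + b*d + c*d"
      and "e3 = a*b*c + a*b*d + a*c*d + b*c*d" and "e4 = a*b*c*d"
    have prod4: "(1 - a * y) * (1 - b * y) * (1 - c * y) * (1 - d * y)
        = 1 - e1 * y + e2 * y\<^sup>2 - e3 * y ^ 3 + e4 * y ^ 4" for y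
      unfolding e1_def e2_def e3_def e4_def by algebra
    have sym: "(1 - w\<^sup>2) * w * (1 - e1 * z + e2 * z\<^sup>2 - e3 * z ^ 3 + e4 * z ^ 4)
        + (1 - z\<^sup>2) * z * (1 - e1 * w + e2 * w\<^sup>2 - e3 * w ^ 3 + e4 * w ^ 4)
        = (1 - z\<^sup>2) * (1 - w\<^sup>2) * ((1 - e4) * (z + w) - (e1 - e3))"
      using zw by algebra
    define U L where "U = (1 - z\<^sup>2) * (1 - w\<^sup>2) * Q" and "L = (1 - e4) * (z + w) - (e1 - e3)"
    have UL: "1 * \<Phi> z + 1 * \<Phi> w = U * L"
      unfolding P1 P2 prod4 mult_1 distrib_right[symmetric] sym U_def L_def by (simp only: mult_ac)
    have az: "(1 - e4) * ((1 - a * z) * (1 - a * w)) = (1 - a * b) * (1 - a * c) * (1 - a * d) - a * L"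
    proof -
      have "(1 - a * z) * (1 - a * w) = 1 + a\<^sup>2 - a * (z + w)" using zw by algebra
      moreover have "(1 - e4) * (1 + a\<^sup>2) - a * (e1 - e3) = (1 - a * b) * (1 - a * c) * (1 - a * d)"
        unfolding e1_def e3_def e4_def by algebra
      ultimately show ?thesis unfolding L_def by algebra
    qed
    have "(1 - a * b * c * d) * aw_kernel q (a * q) b c d z = (1 - e4) * ((1 - a * z) * (1 - a * w)) * U"
      unfolding Wq U_def e4_def by (simp only: mult_ac)
    also have "\<dots> = (1 - a * b) * (1 - a * c) * (1 - a * d) * U + (- a) * (U * L)"
      unfolding az by algebra
    finally show ?thesis
      unfolding w_def[symmetric] UL W U_def .
  qed
  have "(1 - a * b * c * d) * circle_mean (aw_kernel q (a * q) b c d)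
     = circle_mean (\<lambda>z. (1 - a * b) * (1 - a * c) * (1 - a * d) * aw_kernel q a b c d z + (- a) * (1 * \<Phi> z + 1 * \<Phi> (1 / z)))"
  proof -
    have "circle_mean (\<lambda>z. (1 - a * b * c * d) * aw_kernel q (a * q) b c d z)
      = (1 - a * b * c * d) * circle_mean (aw_kernel q (a * q) b c d)"
      by (simp add: circle_mean_def)
    then show ?thesis using circle_mean_cong[OF key] by simp
  qed
  also have "\<dots> = (1 - a * b) * (1 - a * c) * (1 - a * d) * circle_mean (aw_kernel q a b c d)"
    using mean0 circle_mean_inverse[OF cont]
    by (subst circle_mean_linear[OF contW], intro continuous_intros cont cont', subst circle_mean_linear[OF cont cont'])
       simp
  finally show ?thesis by simp
qed

end

section \<open>The Askey-Wilson integral\<close>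

context
  fixes q :: complex
  assumes q1: "norm q < 1" and q0: "q \<noteq> 0"
begin

lemma aw_mean_iterate:
  assumes "norm a < 1" "norm b < 1" "norm c < 1" "norm d < 1"
  shows "qpoch (a * b) q N * qpoch (a * c) q N * qpoch (a * d) q N * circle_mean (aw_kernel q a b c d)
     = qpoch (a * b * c * d) q N * circle_mean (aw_kernel q (a * q ^ N) b c d)"
proof (induction N)
  case (Suc N)
  have "norm (a * q ^ N) \<le> norm a * 1"
    unfolding norm_mult norm_power using q1 by (intro mult_left_mono power_le_one) auto
  then have "norm (a * q ^ N) < 1" using assms by simp
  from aw_mean_recurrence[OF q1 q0 this assms(2-4)]
  have e: "(1 - a * b * q ^ N) * (1 - a * c * q ^ N) * (1 - a * d * q ^ N) * circle_mean (aw_kernel q (a * q ^ N) b c d)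
     = (1 - a * b * c * d * q ^ N) * circle_mean (aw_kernel q (a * q ^ Suc N) b c d)"
    by (simp add: mult_ac)
  have "qpoch (a * b) q (Suc N) * qpoch (a * c) q (Suc N) * qpoch (a * d) q (Suc N) * circle_mean (aw_kernel q a b c d)
      = (qpoch (a * b) q N * qpoch (a * c) q N * qpoch (a * d) q N * circle_mean (aw_kernel q a b c d))
        * ((1 - a * b * q ^ N) * (1 - a * c * q ^ N) * (1 - a * d * q ^ N))"
    by (simp only: qpoch_Suc mult_ac)
  also have "\<dots> = qpoch (a * b * c * d) q N * ((1 - a * b * q ^ N) * (1 - a * c * q ^ N) * (1 - a * d * q ^ N)
        * circle_mean (aw_kernel q (a * q ^ N) b c d))"
    unfolding Suc by (simp only: mult_ac)
  finally show ?case
    unfolding e by (simp only: qpoch_Suc mult_ac)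
qed simp

text \<open>Letting \<open>N\<close> tend to infinity in the iterated recurrence: the mean is continuous in its first
  parameter, and \<open>aq\<^sup>N\<close> tends to zero.\<close>
lemma aw_mean_reduce:
  assumes n: "norm a < 1" "norm b < 1" "norm c < 1" "norm d < 1"
  shows "qpoch_inf (a * b) q * qpoch_inf (a * c) q * qpoch_inf (a * d) q * circle_mean (aw_kernel q a b c d)
     = qpoch_inf (a * b * c * d) q * circle_mean (aw_kernel q 0 b c d)"
proof -
  have cont: "continuous_on (cball 0 (norm a)) (\<lambda>x. circle_mean (aw_kernel q x b c d))"
    unfolding circle_mean_def box_real[symmetric]
    using n by (intro integral_continuous_on_param, unfold case_prod_unfold,
       intro continuous_on_aw_kernel[OF q1] continuous_intros) (auto simp: norm_mult)
  have "(\<lambda>N. a * q ^ N) \<longlonglongrightarrow> a * 0"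
    using q1 by (intro tendsto_mult_left LIMSEQ_power_zero)
  moreover have "a * q ^ N \<in> cball 0 (norm a)" for N
    using mult_left_le[of "norm q ^ N" "norm a"] q1 by (simp add: norm_mult norm_power power_le_one)
  ultimately have "(\<lambda>N. circle_mean (aw_kernel q (a * q ^ N) b c d)) \<longlonglongrightarrow> circle_mean (aw_kernel q 0 b c d)"
    using continuous_on_tendsto_compose[OF cont, of "\<lambda>N. a * q ^ N" 0 sequentially] by simp
  then have "(\<lambda>N. qpoch (a * b * c * d) q N * circle_mean (aw_kernel q (a * q ^ N) b c d))
      \<longlonglongrightarrow> qpoch_inf (a * b * c * d) q * circle_mean (aw_kernel q 0 b c d)"
    by (intro tendsto_mult qpoch_LIMSEQ q1)
  moreover have "(\<lambda>N. qpoch (a * b) q N * qpoch (a * c) q N * qpoch (a * d) q N * circle_mean (aw_kernel q a b c d))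
      \<longlonglongrightarrow> qpoch_inf (a * b) q * qpoch_inf (a * c) q * qpoch_inf (a * d) q * circle_mean (aw_kernel q a b c d)"
    by (intro tendsto_intros qpoch_LIMSEQ q1)
  ultimately show ?thesis
    unfolding aw_mean_iterate[OF n] using LIMSEQ_unique by blast
qed

lemma aw_mean_in_terms_of_zero:
  assumes n: "norm a < 1" "norm b < 1" "norm c < 1" "norm d < 1"
  shows "(\<Prod>x\<leftarrow>[a * b, a * c, a * d, b * c, b * d, c * d]. qpoch_inf x q) * circle_mean (aw_kernel q a b c d)
     = qpoch_inf (a * b * c * d) q * circle_mean (aw_kernel q 0 0 0 0)"
proof -
  have 1: "qpoch_inf (b * c) q * qpoch_inf (b * d) q * circle_mean (aw_kernel q 0 b c d)
      = circle_mean (aw_kernel q 0 0 c d)"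
    using aw_mean_reduce[of b 0 c d] n q1 by (simp add: aw_kernel_commute(1)[of q b 0])
  have "aw_kernel q 0 0 c d = aw_kernel q c 0 0 d"
    by (metis aw_kernel_commute)
  then have 2: "qpoch_inf (c * d) q * circle_mean (aw_kernel q 0 0 c d) = circle_mean (aw_kernel q 0 0 0 d)"
    using aw_mean_reduce[of c 0 0 d] n q1 by simp
  have "aw_kernel q 0 0 0 d = aw_kernel q d 0 0 0"
    by (metis aw_kernel_commute)
  then have 3: "circle_mean (aw_kernel q 0 0 0 d) = circle_mean (aw_kernel q 0 0 0 0)"
    using aw_mean_reduce[of d 0 0 0] n q1 by simp
  show ?thesis
    unfolding 3[symmetric] 2[symmetric] 1[symmetric]
    using aw_mean_reduce[OF n] by (simp add: mult_ac)
qed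

text \<open>The pair with \<open>\<plusminus>q\<close> contributes the even powers of \<open>q\<close> and the pair with \<open>\<plusminus>\<surd>q\<close> the odd
  ones. This makes the kernel with these four parameters elementary.\<close>
lemma qpoch_quadruple:
  assumes s: "s\<^sup>2 = q"
  shows "qpoch (q * y) q n * qpoch (- (q * y)) q n * qpoch (s * y) q n * qpoch (- (s * y)) q n
     = qpoch (q * y\<^sup>2) q (2 * n)"
proof (induction n)
  case (Suc n)
  have "(1 - q * y * Q) * (1 + q * y * Q) * (1 - s * y * Q) * (1 + s * y * Q)
     = (1 - q * y\<^sup>2 * Q\<^sup>2) * (1 - q * y\<^sup>2 * (q * Q\<^sup>2))" for Q
    unfolding s[symmetric] by algebra
  from this[of "q ^ n"] have e:
    "(1 - q * y * q ^ n) * (1 - - (q * y) * q ^ n) * (1 - s * y * q ^ n) * (1 - - (s * y) * q ^ n)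
     = (1 - q * y\<^sup>2 * q ^ (2 * n)) * (1 - q * y\<^sup>2 * q ^ Suc (2 * n))"
    by (simp add: power_even_eq mult.assoc)
  have "qpoch (q * y) q (Suc n) * qpoch (- (q * y)) q (Suc n) * qpoch (s * y) q (Suc n) * qpoch (- (s * y)) q (Suc n)
     = (qpoch (q * y) q n * qpoch (- (q * y)) q n * qpoch (s * y) q n * qpoch (- (s * y)) q n)
       * ((1 - q * y * q ^ n) * (1 - - (q * y) * q ^ n) * (1 - s * y * q ^ n) * (1 - - (s * y) * q ^ n))"
    by (simp only: qpoch_Suc mult_ac)
  also have "\<dots> = qpoch (q * y\<^sup>2) q (2 * Suc n)"
    unfolding Suc e mult_Suc_right add_2_eq_Suc qpoch_Suc by (simp only: mult_ac)
  finally show ?case .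
qed simp

lemma qpoch_inf_quadruple:
  assumes s: "s\<^sup>2 = q"
  shows "qpoch_inf (q * y) q * qpoch_inf (- (q * y)) q * qpoch_inf (s * y) q * qpoch_inf (- (s * y)) q
     = qpoch_inf (q * y\<^sup>2) q"
proof -
  have "(\<lambda>n. qpoch (q * y) q n * qpoch (- (q * y)) q n * qpoch (s * y) q n * qpoch (- (s * y)) q n)
      \<longlonglongrightarrow> qpoch_inf (q * y) q * qpoch_inf (- (q * y)) q * qpoch_inf (s * y) q * qpoch_inf (- (s * y)) q"
    by (intro tendsto_intros qpoch_LIMSEQ q1)
  moreover have "(\<lambda>n. qpoch (q * y\<^sup>2) q (2 * n)) \<longlonglongrightarrow> qpoch_inf (q * y\<^sup>2) q"
    by (rule filterlim_compose[OF qpoch_LIMSEQ[OF q1]]) (rule filterlim_subseq, auto simp: strict_mono_def)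
  ultimately show ?thesis
    unfolding qpoch_quadruple[OF s] using LIMSEQ_unique by blast
qed

text \<open>
  For the parameters \<open>q, -q, \<surd>q, -\<surd>q\<close> the kernel is \<open>(1 - z\<^sup>2)(1 - 1/z\<^sup>2)\<close>, with mean 2. The symbols
  at the products of these parameters simplify by Euler's identity
  \<open>(-q)\<^sub>\<infinity> (\<surd>q)\<^sub>\<infinity> (-\<surd>q)\<^sub>\<infinity> = 1\<close>, the case \<open>y = 1\<close> of the previous lemma.
\<close>
lemma aw_mean_zero: "qpoch_inf q q * circle_mean (aw_kernel q 0 0 0 0) = 2"
proof -
  define s where "s = csqrt q"
  have s: "s\<^sup>2 = q" by (simp add: s_def)
  have ns: "norm s < 1"
  proof -
    have "norm s ^ 2 < 1" using s q1 by (metis norm_power)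
    then show ?thesis by (simp add: power2_eq_square abs_square_less_1 flip: power2_eq_square)
  qed
  have nz: "qpoch_inf x q \<noteq> 0" if "norm x < 1" for x
    by (rule qpoch_inf_nonzero[OF q1 that])
  have ker: "aw_kernel q q (- q) s (- s) z = (1 - z\<^sup>2) * (1 - 1 / z\<^sup>2)" if z: "norm z = 1" for z
  proof -
    have "1 / z \<noteq> 0" "norm (1 / z) = 1" using z by (auto simp: norm_divide)
    have *: "qpoch_inf (q * z\<^sup>2) q \<noteq> 0" "qpoch_inf (q * (1 / z)\<^sup>2) q \<noteq> 0"
      using z q1 by (auto intro!: nz simp: norm_mult norm_power norm_divide)
    have den: "(\<Prod>x\<leftarrow>[q, - q, s, - s]. qpoch_inf (x * z) q * qpoch_inf (x / z) q)
        = qpoch_inf (q * z\<^sup>2) q * qpoch_inf (q * (1 / z)\<^sup>2) q"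
      unfolding qpoch_inf_quadruple[OF s, symmetric] by (simp add: mult_ac)
    have num: "qpoch_inf (x\<^sup>2) q = (1 - x\<^sup>2) * qpoch_inf (q * x\<^sup>2) q" for x
      using qpoch_inf_Suc[OF q1, of "x\<^sup>2"] by (simp add: mult_ac)
    have "aw_kernel q q (- q) s (- s) z
        = ((1 - z\<^sup>2) * qpoch_inf (q * z\<^sup>2) q) * ((1 - (1 / z)\<^sup>2) * qpoch_inf (q * (1 / z)\<^sup>2) q)
          / (qpoch_inf (q * z\<^sup>2) q * qpoch_inf (q * (1 / z)\<^sup>2) q)"
      unfolding aw_kernel_def den num[symmetric] by (simp add: power_one_over)
    then show ?thesis using * by (simp add: power_one_over)
  qed
  have "circle_mean (aw_kernel q q (- q) s (- s)) = circle_mean (\<lambda>z. (1 - z\<^sup>2) * (1 - 1 / z\<^sup>2))"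
    by (rule circle_mean_cong) (rule ker)
  also have "\<dots> = 2"
  proof -
    have "((\<lambda>t. (1 - (cis (2 * pi * t))\<^sup>2) * (1 - 1 / (cis (2 * pi * t))\<^sup>2)) has_integral
       (of_real (2 * 1 - sin (4 * pi * 1) / (2 * pi)) - of_real (2 * 0 - sin (4 * pi * 0) / (2 * pi)))) {0..1}"
    proof (rule fundamental_theorem_of_calculus)
      fix t :: real
      have "(1 - (cis (2 * pi * t))\<^sup>2) * (1 - 1 / (cis (2 * pi * t))\<^sup>2)
         = 2 - (cis (4 * pi * t) + cis (- (4 * pi * t)))"
        by (simp add: Complex.DeMoivre cis_inverse[symmetric] field_simps)
      also have "\<dots> = of_real (2 - 2 * cos (4 * pi * t))"
        by (simp add: complex_eq_iff)
      finally have e: "(1 - (cis (2 * pi * t))\<^sup>2) * (1 - 1 / (cis (2 * pi * t))\<^sup>2) = \<dots>" .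
      have "((\<lambda>t. 2 * t - sin (4 * pi * t) / (2 * pi)) has_real_derivative (2 - 2 * cos (4 * pi * t))) (at t within {0..1})"
        by (auto intro!: derivative_eq_intros simp: field_simps)
      then show "((\<lambda>t. of_real (2 * t - sin (4 * pi * t) / (2 * pi))) has_vector_derivative
          ((1 - (cis (2 * pi * t))\<^sup>2) * (1 - 1 / (cis (2 * pi * t))\<^sup>2))) (at t within {0..1})"
        unfolding e by (rule has_vector_derivative_of_real)
    qed simp
    moreover have "sin (4 * pi) = 0" using sin_npi[of 4] by simp
    ultimately show ?thesis
      unfolding circle_mean_def by (intro integral_unique) simp
  qed
  finally have K: "circle_mean (aw_kernel q q (- q) s (- s)) = 2" .
  have n: "norm (q * s) < 1" "norm (q\<^sup>2) < 1"
    using mult_strict_mono[of "norm q" 1 "norm s" 1] mult_strict_mono[of "norm q" 1 "norm q" 1] q1 ns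
    by (simp_all add: norm_mult power2_eq_square)
  define p where "p = qpoch_inf (q * s) q" define p' where "p' = qpoch_inf (- (q * s)) q"
  define r where "r = qpoch_inf (- (q\<^sup>2)) q"
  have E: "(1 - q) * (1 - q\<^sup>2) * (p\<^sup>2 * p'\<^sup>2 * r * ((1 + q) * r)) = 1"
  proof -
    have m: "qpoch_inf (- q) q = (1 + q) * r"
      using qpoch_inf_Suc[OF q1, of "- q"] by (simp add: r_def power2_eq_square)
    have s1: "qpoch_inf s q = (1 - s) * p" "qpoch_inf (- s) q = (1 + s) * p'"
      using qpoch_inf_Suc[OF q1, of s] qpoch_inf_Suc[OF q1, of "- s"] by (simp_all add: p_def p'_def mult_ac)
    have "qpoch_inf q q * (qpoch_inf (- q) q * qpoch_inf s q * qpoch_inf (- s) q) = qpoch_inf q q * 1"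
      using qpoch_inf_quadruple[OF s, of 1] by (simp add: mult_ac)
    then have "qpoch_inf (- q) q * qpoch_inf s q * qpoch_inf (- s) q = 1"
      using nz[OF q1] by (metis mult_left_cancel)
    then have "((1 + q) * r) * ((1 - s) * p) * ((1 + s) * p') = 1"
      unfolding m s1 .
    then have "(1 - q) * (1 + q) * r * p * p' = 1" using s by algebra
    then show ?thesis by algebra
  qed
  have q3: "qpoch_inf q q = (1 - q) * (1 - q\<^sup>2) * qpoch_inf (q ^ 3) q"
    using qpoch_inf_split[OF q1, of q 2] by (simp add: qpoch_def numeral_2_eq_2 power2_eq_square power3_eq_cube mult_ac)
  have sq: "q * - q * s * - s = q ^ 3" unfolding s[symmetric] by algebra
  have "(p\<^sup>2 * p'\<^sup>2 * r * ((1 + q) * r)) * 2 = qpoch_inf (q ^ 3) q * circle_mean (aw_kernel q 0 0 0 0)"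
  proof -
    have m: "qpoch_inf (- q) q = (1 + q) * r"
      using qpoch_inf_Suc[OF q1, of "- q"] by (simp add: r_def power2_eq_square)
    have "s * s = q" using s by (simp add: power2_eq_square)
    then show ?thesis
      using aw_mean_in_terms_of_zero[of q "- q" s "- s"] q1 ns unfolding sq K
      by (simp add: m p_def p'_def r_def power2_eq_square mult_ac)
  qed
  then have "(1 - q) * (1 - q\<^sup>2) * (p\<^sup>2 * p'\<^sup>2 * r * ((1 + q) * r)) * 2
      = qpoch_inf q q * circle_mean (aw_kernel q 0 0 0 0)"
    unfolding q3 by (simp add: mult.assoc)
  then show ?thesis unfolding E by simp
qed

theorem askey_wilson_integral:
  assumes n: "norm a < 1" "norm b < 1" "norm c < 1" "norm d < 1"
  shows "((\<lambda>\<theta>. aw_kernel q a b c d (cis \<theta>)) has_integral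
     2 * of_real pi * qpoch_inf (a * b * c * d) q
       / qpochs_inf [q, a * b, a * c, a * d, b * c, b * d, c * d] q) {0..pi}"
proof -
  have nz: "qpoch_inf q q \<noteq> 0" "qpoch_inf (x * y) q \<noteq> 0" if "norm x < 1" "norm y < 1" for x y
    using that mult_strict_mono[of "norm x" 1 "norm y" 1] q1
    by (simp_all add: qpoch_inf_nonzero[OF q1] norm_mult)
  define R where "R = (\<Prod>x\<leftarrow>[a * b, a * c, a * d, b * c, b * d, c * d]. qpoch_inf x q)"
  have R: "R \<noteq> 0" using n nz(2) by (simp add: R_def)
  have "qpoch_inf q q * (R * circle_mean (aw_kernel q a b c d)) = 2 * qpoch_inf (a * b * c * d) q"
    unfolding R_def aw_mean_in_terms_of_zero[OF n] using aw_mean_zero by (metis mult.commute mult.left_commute)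
  then have "circle_mean (aw_kernel q a b c d) = 2 * qpoch_inf (a * b * c * d) q / (qpoch_inf q q * R)"
    using R nz(1)[of 0 0] by (simp add: field_simps)
  moreover have "((\<lambda>\<theta>. aw_kernel q a b c d (cis \<theta>)) has_integral of_real pi * circle_mean (aw_kernel q a b c d)) {0..pi}"
    using n by (intro has_integral_half_circle continuous_on_aw_kernel[OF q1] aw_kernel_inverse continuous_intros)
      (auto simp: aw_kernel_inverse q1)
  ultimately show ?thesis
    by (simp add: R_def qpochs_inf_def mult_ac)
qed

end

section \<open>Integrating the generating function against a polynomial, coefficient by coefficient\<close>

text \<open>The terminating \<open>\<^sub>4\<phi>\<^sub>3\<close> in the definition of the Askey-Wilson polynomials, as a finite sum.\<close>
definition aw_phi :: "complex \<Rightarrow> nat \<Rightarrow> complex \<Rightarrow> complex \<Rightarrow> complex \<Rightarrow> complex \<Rightarrow> complex \<Rightarrow> complex" where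
  "aw_phi q n a b c d z = (\<Sum>k\<le>n. qpoch (1 / q ^ n) q k * qpoch (a * b * c * d * q ^ n / q) q k * q ^ k
      / (qpoch q q k * qpoch (a * b) q k * qpoch (a * c) q k * qpoch (a * d) q k)
      * (qpoch (a * z) q k * qpoch (a / z) q k))"

text \<open>The coefficient of \<open>t\<^sup>m\<close> in the product of the two \<open>\<^sub>2\<phi>\<^sub>1\<close>.\<close>
definition aw_gf_coeff :: "complex \<Rightarrow> nat \<Rightarrow> complex \<Rightarrow> complex \<Rightarrow> complex \<Rightarrow> complex \<Rightarrow> complex \<Rightarrow> complex" where
  "aw_gf_coeff q m a b c d z = (\<Sum>i\<le>m. qpoch (a * z) q i * qpoch (b * z) q i / (qpoch q q i * qpoch (a * b) q i) * (1 / z) ^ i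
           * (qpoch (c / z) q (m - i) * qpoch (d / z) q (m - i)
              / (qpoch q q (m - i) * qpoch (c * d) q (m - i)) * z ^ (m - i)))"

text \<open>The value of the Askey-Wilson integral.\<close>
definition aw_total :: "complex \<Rightarrow> complex \<Rightarrow> complex \<Rightarrow> complex \<Rightarrow> complex \<Rightarrow> complex" where
  "aw_total q a b c d = 2 * of_real pi * qpoch_inf (a * b * c * d) q
       / qpochs_inf [q, a * b, a * c, a * d, b * c, b * d, c * d] q"

lemma aw_total_prod: "aw_total q a b c d = 2 * of_real pi * qpoch_inf (a * b * c * d) q
   / (qpoch_inf q q * (qpoch_inf (a * b) q * (qpoch_inf (a * c) q * (qpoch_inf (a * d) q
      * (qpoch_inf (b * c) q * (qpoch_inf (b * d) q * qpoch_inf (c * d) q))))))"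
  by (simp add: aw_total_def qpochs_inf_def)

lemma norm_mult_less_1: "norm x < 1 \<Longrightarrow> norm y < 1 \<Longrightarrow> norm (x * y) < 1" for x y :: complex
  using mult_strict_mono[of "norm x" 1 "norm y" 1] by (simp add: norm_mult)

context
  fixes q :: complex
  assumes q1: "norm q < 1" and q0: "q \<noteq> 0"
begin

lemma norm_mult_q_power_less_1: "norm x < 1 \<Longrightarrow> norm (x * q ^ k) < 1"
  using mult_left_le[of "norm q ^ k" "norm x"] q1 by (simp add: norm_mult norm_power power_le_one)

lemma qpoch_inf_shift:
  assumes "norm x < 1"
  shows "qpoch_inf (x * q ^ k) q = qpoch_inf x q / qpoch x q k"
  using qpoch_inf_split[OF q1, of x k] qpoch_nonzero[OF assms q1, of k] by simp

lemma aw_kernel_shift: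
  assumes "norm a < 1" "norm z = 1"
  shows "qpoch (a * z) q k * qpoch (a / z) q k * aw_kernel q a b c d z = aw_kernel q (a * q ^ k) b c d z"
proof -
  have n: "norm (a * z) < 1" "norm (a / z) < 1" using assms by (simp_all add: norm_mult norm_divide)
  have e: "a * q ^ k * z = a * z * q ^ k" "a * q ^ k / z = a / z * q ^ k" by simp_all
  show ?thesis
    unfolding aw_kernel_def list.map e qpoch_inf_shift[OF n(1)] qpoch_inf_shift[OF n(2)]
    using qpoch_nonzero[OF n(1) q1, of k] qpoch_nonzero[OF n(2) q1, of k] by (simp add: mult_ac)
qed

text \<open>The two finite products turn the kernel into the one with parameters \<open>aq\<^sup>j, bq\<^sup>k, c, d\<close>, so the
  integral is a quotient of values of the Askey-Wilson integral.\<close>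
lemma aw_moment:
  assumes n: "norm a < 1" "norm b < 1" "norm c < 1" "norm d < 1"
  shows "((\<lambda>\<theta>. qpoch (a * cis \<theta>) q j * qpoch (a / cis \<theta>) q j * (qpoch (b * cis \<theta>) q k * qpoch (b / cis \<theta>) q k)
       * aw_kernel q a b c d (cis \<theta>)) has_integral
     aw_total q a b c d * (qpoch (a * b) q (k + j) * qpoch (a * c) q j * qpoch (a * d) q j
       * qpoch (b * c) q k * qpoch (b * d) q k) / qpoch (a * b * c * d) q (k + j)) {0..pi}"
proof -
  have e: "qpoch (a * cis \<theta>) q j * qpoch (a / cis \<theta>) q j * (qpoch (b * cis \<theta>) q k * qpoch (b / cis \<theta>) q k)
       * aw_kernel q a b c d (cis \<theta>) = aw_kernel q (a * q ^ j) (b * q ^ k) c d (cis \<theta>)" for \<theta>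
  proof -
    have "aw_kernel q (a * q ^ j) (b * q ^ k) c d (cis \<theta>) = aw_kernel q (b * q ^ k) (a * q ^ j) c d (cis \<theta>)"
      by (simp only: aw_kernel_commute(1)[of q "a * q ^ j"])
    also have "\<dots> = qpoch (b * cis \<theta>) q k * qpoch (b / cis \<theta>) q k * aw_kernel q (a * q ^ j) b c d (cis \<theta>)"
      unfolding aw_kernel_commute(1)[of q "a * q ^ j" b]
      by (rule aw_kernel_shift[OF n(2) norm_cis, symmetric])
    also have "aw_kernel q (a * q ^ j) b c d (cis \<theta>)
        = qpoch (a * cis \<theta>) q j * qpoch (a / cis \<theta>) q j * aw_kernel q a b c d (cis \<theta>)"
      using aw_kernel_shift[OF n(1), of "cis \<theta>" j b c d] by simp
    finally show ?thesis by (simp add: mult_ac)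
  qed
  have abcd: "norm (a * b * c * d) < 1" by (intro norm_mult_less_1 n)
  have p: "a * q ^ j * (b * q ^ k) = a * b * q ^ (k + j)" "a * q ^ j * c = a * c * q ^ j"
    "a * q ^ j * d = a * d * q ^ j" "b * q ^ k * c = b * c * q ^ k" "b * q ^ k * d = b * d * q ^ k"
    "a * b * q ^ (k + j) * c * d = a * b * c * d * q ^ (k + j)"
    by (simp_all add: power_add)
  have "aw_total q (a * q ^ j) (b * q ^ k) c d = aw_total q a b c d * (qpoch (a * b) q (k + j) * qpoch (a * c) q j * qpoch (a * d) q j
       * qpoch (b * c) q k * qpoch (b * d) q k) / qpoch (a * b * c * d) q (k + j)"
    unfolding aw_total_def p qpochs_inf_def list.map
      qpoch_inf_shift[OF abcd] qpoch_inf_shift[OF norm_mult_less_1[OF n(1,2)]]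
      qpoch_inf_shift[OF norm_mult_less_1[OF n(1,3)]] qpoch_inf_shift[OF norm_mult_less_1[OF n(1,4)]]
      qpoch_inf_shift[OF norm_mult_less_1[OF n(2,3)]] qpoch_inf_shift[OF norm_mult_less_1[OF n(2,4)]]
    by (simp add: mult_ac)
  moreover have "((\<lambda>\<theta>. aw_kernel q (a * q ^ j) (b * q ^ k) c d (cis \<theta>)) has_integral
      aw_total q (a * q ^ j) (b * q ^ k) c d) {0..pi}"
    unfolding aw_total_def by (intro askey_wilson_integral q1 q0 norm_mult_q_power_less_1 n)
  ultimately show ?thesis unfolding e by simp
qed

lemma aw_gf_coeff_conv_aw_phi:
  assumes "z \<noteq> 0" "b \<noteq> 0" "c \<noteq> 0" "d \<noteq> 0"
    and n: "norm a < 1" "norm b < 1" "norm c < 1" "norm d < 1"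
  shows "aw_gf_coeff q m a b c d z
    = qpoch (b * c) q m * qpoch (b * d) q m / (b ^ m * qpoch q q m * qpoch (c * d) q m) * aw_phi q m b a c d z"
  unfolding aw_gf_coeff_def
  by (subst sears_transformation[OF q1 q0 assms(1-4)])
     (use n in \<open>simp_all add: qpoch_nonzero norm_mult_less_1 q1 aw_phi_def mult_ac\<close>)

text \<open>
  Expanding both factors gives a double sum of moments. The sum over the index \<open>j\<close> of the polynomial
  with base \<open>\<alpha>\<close> is balanced and produces the factor \<open>(q\<^sup>-\<^sup>k)\<^sub>n\<close>. The terms with \<open>k < n\<close> therefore vanish, and
  shifting \<open>k\<close> by \<open>n\<close> leaves a second balanced sum, over \<open>i \<le> m - n\<close>.
\<close>
lemma aw_phi_product_integral:
  assumes n: "norm \<alpha> < 1" "norm a < 1" "norm b < 1" "norm c < 1" "norm d < 1"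
    and nz: "\<alpha> \<noteq> 0" "b \<noteq> 0" "c \<noteq> 0" "d \<noteq> 0"
  shows "((\<lambda>\<theta>. aw_phi q m b a c d (cis \<theta>) * aw_phi q n \<alpha> b c d (cis \<theta>) * aw_kernel q \<alpha> b c d (cis \<theta>))
     has_integral (if m < n then 0 else
       aw_total q \<alpha> b c d * (qpoch q q m * qpoch (c * d) q m * qpoch (a * b * c * d * q ^ m / q) q n
          * (\<alpha> * b) ^ m * qpoch (a / \<alpha>) q (m - n))
         / (qpoch q q (m - n) * qpoch (a * b) q m * qpoch (\<alpha> * b * c * d) q (n + m)))) {0..pi}"
proof -
  define V where "V = aw_total q \<alpha> b c d"
  define cf where "cf j = qpoch (1 / q ^ n) q j * qpoch (\<alpha> * b * c * d * q ^ n / q) q j * q ^ j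
      / (qpoch q q j * qpoch (\<alpha> * b) q j * qpoch (\<alpha> * c) q j * qpoch (\<alpha> * d) q j)" for j
  define df where "df k = qpoch (1 / q ^ m) q k * qpoch (b * a * c * d * q ^ m / q) q k * q ^ k
      / (qpoch q q k * qpoch (b * a) q k * qpoch (b * c) q k * qpoch (b * d) q k)" for k
  define mom where "mom k j = V * (qpoch (\<alpha> * b) q (k + j) * qpoch (\<alpha> * c) q j * qpoch (\<alpha> * d) q j
       * qpoch (b * c) q k * qpoch (b * d) q k) / qpoch (\<alpha> * b * c * d) q (k + j)" for k j
  have n': "norm (\<alpha> * b) < 1" "norm (\<alpha> * c) < 1" "norm (\<alpha> * d) < 1" "norm (b * a) < 1" "norm (a * b) < 1"
    "norm (b * c) < 1" "norm (b * d) < 1" "norm (c * d) < 1" "norm (\<alpha> * b * c * d) < 1"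
    by (intro norm_mult_less_1 n)+
  note nn = n'[THEN qpoch_nonzero, OF q1]
  note nns = n'[THEN norm_mult_q_power_less_1, THEN qpoch_nonzero, OF q1]
  have "((\<lambda>\<theta>. \<Sum>k\<le>m. \<Sum>j\<le>n. df k * cf j * (qpoch (\<alpha> * cis \<theta>) q j * qpoch (\<alpha> / cis \<theta>) q j
        * (qpoch (b * cis \<theta>) q k * qpoch (b / cis \<theta>) q k) * aw_kernel q \<alpha> b c d (cis \<theta>)))
     has_integral (\<Sum>k\<le>m. \<Sum>j\<le>n. df k * cf j * mom k j)) {0..pi}"
    unfolding mom_def V_def
    by (intro has_integral_sum has_integral_mult_right aw_moment n finite_atMost)
  moreover have "aw_phi q m b a c d (cis \<theta>) * aw_phi q n \<alpha> b c d (cis \<theta>) * aw_kernel q \<alpha> b c d (cis \<theta>)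
     = (\<Sum>k\<le>m. \<Sum>j\<le>n. df k * cf j * (qpoch (\<alpha> * cis \<theta>) q j * qpoch (\<alpha> / cis \<theta>) q j
        * (qpoch (b * cis \<theta>) q k * qpoch (b / cis \<theta>) q k) * aw_kernel q \<alpha> b c d (cis \<theta>)))" for \<theta>
    unfolding aw_phi_def cf_def[symmetric] df_def[symmetric]
    by (simp add: sum_distrib_right sum_distrib_left mult_ac)
  ultimately have main: "((\<lambda>\<theta>. aw_phi q m b a c d (cis \<theta>) * aw_phi q n \<alpha> b c d (cis \<theta>) * aw_kernel q \<alpha> b c d (cis \<theta>))
     has_integral (\<Sum>k\<le>m. \<Sum>j\<le>n. df k * cf j * mom k j)) {0..pi}"
    by simp
  define G where "G k = df k * V * qpoch (\<alpha> * b) q k * qpoch (b * c) q k * qpoch (b * d) q k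
      / qpoch (\<alpha> * b * c * d) q k * ((\<alpha> * b * q ^ k) ^ n * qpoch (1 / q ^ k) q n * qpoch (c * d) q n
         / (qpoch (\<alpha> * b) q n * qpoch (\<alpha> * b * c * d * q ^ k) q n))" for k
  have inner: "(\<Sum>j\<le>n. df k * cf j * mom k j) = G k" for k
  proof -
    have u: "\<alpha> * b * q ^ k * (1 / q ^ k) = \<alpha> * b" "\<alpha> * b * q ^ k * (c * d) = \<alpha> * b * c * d * q ^ k"
      using q0 by simp_all
    have "(\<Sum>j\<le>n. df k * cf j * mom k j) = df k * V * qpoch (\<alpha> * b) q k * qpoch (b * c) q k * qpoch (b * d) q k
      / qpoch (\<alpha> * b * c * d) q k * (\<Sum>j\<le>n. qpoch (1 / q ^ n) q j * qpoch (\<alpha> * b * q ^ k) q j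
        * qpoch (\<alpha> * b * c * d * q ^ n / q) q j * q ^ j
        / (qpoch q q j * qpoch (\<alpha> * b * q ^ k * (1 / q ^ k)) q j * qpoch (\<alpha> * b * q ^ k * (c * d)) q j))"
      unfolding sum_distrib_left u cf_def mom_def qpoch_add using nn
      by (intro sum.cong refl) (simp add: mult_ac)
    also have "(\<Sum>j\<le>n. qpoch (1 / q ^ n) q j * qpoch (\<alpha> * b * q ^ k) q j
        * qpoch (\<alpha> * b * c * d * q ^ n / q) q j * q ^ j
        / (qpoch q q j * qpoch (\<alpha> * b * q ^ k * (1 / q ^ k)) q j * qpoch (\<alpha> * b * q ^ k * (c * d)) q j))
      = (\<alpha> * b * q ^ k) ^ n * qpoch (1 / q ^ k) q n * qpoch (c * d) q n
         / (qpoch (\<alpha> * b * q ^ k * (1 / q ^ k)) q n * qpoch (\<alpha> * b * q ^ k * (c * d)) q n)"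
    proof (rule q_saalschuetz[OF q1 q0])
      show "\<alpha> * b * c * d * q ^ n / q * q = \<alpha> * b * q ^ k * (1 / q ^ k) * (c * d) * q ^ n"
        unfolding u using q0 by simp
      show "qpoch (\<alpha> * b * q ^ k * (1 / q ^ k)) q n \<noteq> 0" "qpoch (\<alpha> * b * q ^ k * (c * d)) q n \<noteq> 0"
        unfolding u by (rule nn nns)+
    qed (use nz q0 in simp_all)
    finally show ?thesis unfolding G_def u .
  qed
  have G0: "G k = 0" if "k < n" for k
  proof -
    have "qpoch (1 / q ^ k) q n = 0"
      using that q0 by (auto simp: qpoch_def intro!: bexI[of _ k])
    then show ?thesis by (simp add: G_def)
  qed
  show ?thesis
  proof (cases "m < n")
    case True
    then have "(\<Sum>k\<le>m. \<Sum>j\<le>n. df k * cf j * mom k j) = 0"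
      by (simp add: inner G0)
    with main True show ?thesis by simp
  next
    case False
    then obtain N where m: "m = n + N" using le_Suc_ex not_less by blast
    have "(\<Sum>k\<le>m. \<Sum>j\<le>n. df k * cf j * mom k j) = (\<Sum>k\<in>{n..n + N}. G k)"
      unfolding inner by (rule sum.mono_neutral_right) (auto simp: m G0)
    also have "\<dots> = (\<Sum>i\<le>N. G (n + i))"
      using sum.shift_bounds_cl_nat_ivl[of G 0 n N] by (simp add: add.commute atMost_atLeast0)
    finally have S: "(\<Sum>k\<le>m. \<Sum>j\<le>n. df k * cf j * mom k j) = \<dots>" .
    define \<sigma> where "\<sigma> = (\<Prod>r<n. - (q ^ r))"
    define K where "K = V * qpoch (c * d) q n * (\<alpha> * b) ^ n * \<sigma> * q ^ n * qpoch (1 / q ^ m) q n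
       * qpoch (a * b * c * d * q ^ m / q) q n / (qpoch (a * b) q n * qpoch (\<alpha> * b * c * d) q (n + n))"
    have u: "\<alpha> * b * q ^ n * (a / \<alpha>) = a * b * q ^ n"
      "\<alpha> * b * q ^ n * (c * d * q ^ n) = \<alpha> * b * c * d * q ^ (n + n)"
      using nz by (simp_all add: power_add)
    have Gi: "G (n + i) = K * (qpoch (1 / q ^ N) q i * qpoch (\<alpha> * b * q ^ n) q i
        * qpoch (a * b * c * d * q ^ m / q * q ^ n) q i * q ^ i
        / (qpoch q q i * qpoch (\<alpha> * b * q ^ n * (a / \<alpha>)) q i * qpoch (\<alpha> * b * q ^ n * (c * d * q ^ n)) q i))" for i
    proof -
      have pr: "(\<alpha> * b * q ^ (n + i)) ^ n * (\<Prod>r<n. - (q ^ r / q ^ (n + i))) = (\<alpha> * b) ^ n * \<sigma>"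
      proof -
        have "(\<alpha> * b * q ^ (n + i)) ^ n * (\<Prod>r<n. - (q ^ r / q ^ (n + i)))
           = (\<Prod>r<n. \<alpha> * b * q ^ (n + i) * - (q ^ r / q ^ (n + i)))"
          by (subst prod.distrib) simp
        also have "\<dots> = (\<Prod>r<n. \<alpha> * b * - (q ^ r))"
          using q0 by (intro prod.cong refl) simp
        also have "\<dots> = (\<alpha> * b) ^ n * \<sigma>"
          unfolding \<sigma>_def by (subst prod.distrib) simp
        finally show ?thesis .
      qed
      have neg: "(\<alpha> * b * q ^ (n + i)) ^ n * qpoch (1 / q ^ (n + i)) q n
          = (\<alpha> * b) ^ n * \<sigma> * qpoch q q (n + i) / qpoch q q i"
        using qpoch_negative_power[OF q1 q0, of n "n + i"] pr by simp
      have s1: "qpoch (\<alpha> * b * c * d) q (n + i) * qpoch (\<alpha> * b * c * d * q ^ (n + i)) q n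
          = qpoch (\<alpha> * b * c * d) q (n + n) * qpoch (\<alpha> * b * c * d * q ^ (n + n)) q i"
        by (simp only: qpoch_add[symmetric] add_ac)
      have s2: "1 / q ^ m * q ^ n = 1 / q ^ N" using q0 by (simp add: m power_add)
      have "G (n + i) = df (n + i) * V * qpoch (\<alpha> * b) q (n + i) * qpoch (b * c) q (n + i) * qpoch (b * d) q (n + i)
         * ((\<alpha> * b * q ^ (n + i)) ^ n * qpoch (1 / q ^ (n + i)) q n) * qpoch (c * d) q n
         / (qpoch (\<alpha> * b) q n * (qpoch (\<alpha> * b * c * d) q (n + i) * qpoch (\<alpha> * b * c * d * q ^ (n + i)) q n))"
        by (simp add: G_def mult_ac)
      also have "\<dots> = df (n + i) * V * qpoch (\<alpha> * b) q (n + i) * qpoch (b * c) q (n + i) * qpoch (b * d) q (n + i)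
         * ((\<alpha> * b) ^ n * \<sigma> * qpoch q q (n + i) / qpoch q q i) * qpoch (c * d) q n
         / (qpoch (\<alpha> * b) q n * (qpoch (\<alpha> * b * c * d) q (n + n) * qpoch (\<alpha> * b * c * d * q ^ (n + n)) q i))"
        unfolding neg s1 ..
      also have "\<dots> = qpoch (1 / q ^ m) q n * qpoch (1 / q ^ N) q i
          * (qpoch (a * b * c * d * q ^ m / q) q n * qpoch (a * b * c * d * q ^ m / q * q ^ n) q i)
          * (q ^ n * q ^ i) / (qpoch (a * b) q n * qpoch (a * b * q ^ n) q i)
          * V * qpoch (\<alpha> * b * q ^ n) q i * ((\<alpha> * b) ^ n * \<sigma> / qpoch q q i) * qpoch (c * d) q n
         / (qpoch (\<alpha> * b * c * d) q (n + n) * qpoch (\<alpha> * b * c * d * q ^ (n + n)) q i)"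
        unfolding df_def mult.commute[of b a] qpoch_add[of "1 / q ^ m"] s2
          qpoch_add[of "a * b * c * d * q ^ m / q"] qpoch_add[of "a * b"] qpoch_add[of "\<alpha> * b" q n i] power_add[of q n i]
        using nn qpoch_qq_nonzero[OF q1] by (simp add: mult_ac)
      finally show ?thesis unfolding K_def u by (simp add: mult_ac)
    qed
    have saal: "(\<Sum>i\<le>N. qpoch (1 / q ^ N) q i * qpoch (\<alpha> * b * q ^ n) q i
        * qpoch (a * b * c * d * q ^ m / q * q ^ n) q i * q ^ i
        / (qpoch q q i * qpoch (\<alpha> * b * q ^ n * (a / \<alpha>)) q i * qpoch (\<alpha> * b * q ^ n * (c * d * q ^ n)) q i))
      = (\<alpha> * b * q ^ n) ^ N * qpoch (a / \<alpha>) q N * qpoch (c * d * q ^ n) q N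
        / (qpoch (\<alpha> * b * q ^ n * (a / \<alpha>)) q N * qpoch (\<alpha> * b * q ^ n * (c * d * q ^ n)) q N)"
    proof (rule q_saalschuetz[OF q1 q0])
      show "a * b * c * d * q ^ m / q * q ^ n * q = \<alpha> * b * q ^ n * (a / \<alpha>) * (c * d * q ^ n) * q ^ N"
        unfolding u m using q0 by (simp add: power_add)
      show "qpoch (\<alpha> * b * q ^ n * (a / \<alpha>)) q N \<noteq> 0" "qpoch (\<alpha> * b * q ^ n * (c * d * q ^ n)) q N \<noteq> 0"
        unfolding u by (rule nns)+
    qed (use nz q0 in simp_all)
    \<comment> \<open>All powers of \<open>q\<close> and all signs cancel, because the first \<open>n\<close> odd numbers sum to \<open>n\<^sup>2\<close>.\<close>
    have qs: "\<sigma> * q ^ n * qpoch (1 / q ^ m) q n * (q ^ n) ^ N = qpoch q q m / qpoch q q N"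
    proof -
      have "(\<Prod>r<n'. q ^ r * q ^ r * q) = (q ^ n') ^ n'" for n'
        by (induction n') (simp_all add: power_mult_distrib power_add mult_ac)
      then have sq: "(\<Prod>r<n. q ^ r * q ^ r * q) = (q ^ n) ^ n" .
      have "\<sigma> * (\<Prod>r<n. - (q ^ r / q ^ m)) * q ^ n * (q ^ n) ^ N
         = \<sigma> * (\<Prod>r<n. - (q ^ r / q ^ m)) * q ^ n * (q ^ N) ^ n"
        by (simp add: mult.commute flip: power_mult)
      also have "\<dots> = (\<Prod>r<n. - (q ^ r) * - (q ^ r / q ^ m) * q * q ^ N)"
        unfolding \<sigma>_def prod.distrib by simp
      also have "\<dots> = (\<Prod>r<n. (q ^ r * q ^ r * q) * (1 / q ^ n))"
        using q0 by (intro prod.cong refl) (simp add: m power_add)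
      also have "\<dots> = (q ^ n) ^ n * (1 / q ^ n) ^ n"
        by (subst prod.distrib, subst sq) simp
      also have "\<dots> = 1" using q0 by (simp add: power_divide)
      finally have "\<sigma> * (\<Prod>r<n. - (q ^ r / q ^ m)) * q ^ n * (q ^ n) ^ N = 1" .
      moreover have "qpoch (1 / q ^ m) q n = (\<Prod>r<n. - (q ^ r / q ^ m)) * qpoch q q m / qpoch q q N"
        using qpoch_negative_power[OF q1 q0, of n m] by (simp add: m)
      ultimately show ?thesis by (simp add: mult_ac)
    qed
    have "(\<Sum>i\<le>N. G (n + i)) = K * ((\<alpha> * b * q ^ n) ^ N * qpoch (a / \<alpha>) q N * qpoch (c * d * q ^ n) q N
        / (qpoch (a * b * q ^ n) q N * qpoch (\<alpha> * b * c * d * q ^ (n + n)) q N))"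
      unfolding Gi sum_distrib_left[symmetric] saal unfolding u ..
    also have "\<dots> = V * (\<sigma> * q ^ n * qpoch (1 / q ^ m) q n * (q ^ n) ^ N)
       * (qpoch (c * d) q n * qpoch (c * d * q ^ n) q N) * ((\<alpha> * b) ^ n * (\<alpha> * b) ^ N)
       * qpoch (a * b * c * d * q ^ m / q) q n * qpoch (a / \<alpha>) q N
       / ((qpoch (a * b) q n * qpoch (a * b * q ^ n) q N)
          * (qpoch (\<alpha> * b * c * d) q (n + n) * qpoch (\<alpha> * b * c * d * q ^ (n + n)) q N))"
      unfolding K_def power_mult_distrib[of "\<alpha> * b" "q ^ n" N] by (simp add: mult_ac)
    also have "\<dots> = V * (qpoch q q m * qpoch (c * d) q m * qpoch (a * b * c * d * q ^ m / q) q n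
          * (\<alpha> * b) ^ m * qpoch (a / \<alpha>) q (m - n))
         / (qpoch q q (m - n) * qpoch (a * b) q m * qpoch (\<alpha> * b * c * d) q (n + m))"
      unfolding qs qpoch_add[symmetric] power_add[symmetric] by (simp add: m add.assoc mult_ac)
    finally show ?thesis using main False unfolding S V_def by simp
  qed
qed

lemma aw_gf_coeff_integral_generic:
  assumes n: "norm \<alpha> < 1" "norm a < 1" "norm b < 1" "norm c < 1" "norm d < 1"
    and nz: "\<alpha> \<noteq> 0" "b \<noteq> 0" "c \<noteq> 0" "d \<noteq> 0"
  shows "((\<lambda>\<theta>. aw_gf_coeff q m a b c d (cis \<theta>) * aw_phi q n \<alpha> b c d (cis \<theta>) * aw_kernel q \<alpha> b c d (cis \<theta>))
     has_integral (if m < n then 0 else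
       aw_total q \<alpha> b c d * (qpoch (b * c) q m * qpoch (b * d) q m * qpoch (a * b * c * d * q ^ m / q) q n
          * (\<alpha> ^ m * qpoch (a / \<alpha>) q (m - n)))
         / (qpoch q q (m - n) * qpoch (a * b) q m * qpoch (\<alpha> * b * c * d) q (n + m)))) {0..pi}"
proof -
  define C where "C = qpoch (b * c) q m * qpoch (b * d) q m / (b ^ m * qpoch q q m * qpoch (c * d) q m)"
  have "qpoch (c * d) q m \<noteq> 0" by (intro qpoch_nonzero norm_mult_less_1 n q1)
  moreover have e: "aw_gf_coeff q m a b c d (cis \<theta>) * aw_phi q n \<alpha> b c d (cis \<theta>) * aw_kernel q \<alpha> b c d (cis \<theta>)
    = C * (aw_phi q m b a c d (cis \<theta>) * aw_phi q n \<alpha> b c d (cis \<theta>) * aw_kernel q \<alpha> b c d (cis \<theta>))" for \<theta>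
    using aw_gf_coeff_conv_aw_phi[OF _ nz(2-4) n(2-5), of "cis \<theta>" m] by (simp add: C_def)
  ultimately have v: "C * (if m < n then 0 else
       aw_total q \<alpha> b c d * (qpoch q q m * qpoch (c * d) q m * qpoch (a * b * c * d * q ^ m / q) q n
          * (\<alpha> * b) ^ m * qpoch (a / \<alpha>) q (m - n))
         / (qpoch q q (m - n) * qpoch (a * b) q m * qpoch (\<alpha> * b * c * d) q (n + m)))
      = (if m < n then 0 else
       aw_total q \<alpha> b c d * (qpoch (b * c) q m * qpoch (b * d) q m * qpoch (a * b * c * d * q ^ m / q) q n
          * (\<alpha> ^ m * qpoch (a / \<alpha>) q (m - n)))
         / (qpoch q q (m - n) * qpoch (a * b) q m * qpoch (\<alpha> * b * c * d) q (n + m)))"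
    using nz qpoch_qq_nonzero[OF q1, of m] by (simp add: C_def power_mult_distrib mult_ac)
  show ?thesis
    using has_integral_mult_right[OF aw_phi_product_integral[OF n nz, of m n], of C]
    unfolding v e .
qed

end

section \<open>Removing the restriction to nonzero parameters\<close>

text \<open>The integral of the \<open>m\<close>-th coefficient of the generating function against the \<open>n\<close>-th \<open>\<^sub>4\<phi>\<^sub>3\<close>. The
  factor \<open>\<alpha>\<^sup>m (a/\<alpha>)\<^sub>m\<^sub>-\<^sub>n\<close> is \<open>\<alpha>\<^sup>n\<close> times the product of the \<open>\<alpha> - aq\<^sup>i\<close> with \<open>i < m - n\<close>.\<close>
definition aw_gf_integral :: "complex \<Rightarrow> nat \<Rightarrow> nat \<Rightarrow> complex \<Rightarrow> complex \<Rightarrow> complex \<Rightarrow> complex \<Rightarrow> complex \<Rightarrow> complex" where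
  "aw_gf_integral q m n \<alpha> a b c d = (if m < n then 0 else
       aw_total q \<alpha> b c d * (qpoch (b * c) q m * qpoch (b * d) q m * qpoch (a * b * c * d * q ^ m / q) q n
          * (\<alpha> ^ m * qpoch (a / \<alpha>) q (m - n)))
         / (qpoch q q (m - n) * qpoch (a * b) q m * qpoch (\<alpha> * b * c * d) q (n + m)))"

context
  fixes q :: complex
  assumes q1: "norm q < 1" and q0: "q \<noteq> 0"
begin

lemma qpoch_mult_nonzero: "norm x < 1 \<Longrightarrow> norm y < 1 \<Longrightarrow> qpoch (x * y) q k \<noteq> 0"
  by (intro qpoch_nonzero norm_mult_less_1 q1)

lemma continuous_on_aw_gf_coeff:
  assumes "continuous_on S a" "continuous_on S b" "continuous_on S c" "continuous_on S d" "continuous_on S z"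
    and "\<And>x. x \<in> S \<Longrightarrow> norm (a x) < 1 \<and> norm (b x) < 1 \<and> norm (c x) < 1 \<and> norm (d x) < 1 \<and> norm (z x) = 1"
  shows "continuous_on S (\<lambda>x. aw_gf_coeff q m (a x) (b x) (c x) (d x) (z x))"
proof -
  have "z x \<noteq> 0" if "x \<in> S" for x using assms(6)[OF that] by auto
  with assms show ?thesis
    unfolding aw_gf_coeff_def
    by (auto intro!: continuous_intros simp: qpoch_mult_nonzero qpoch_qq_nonzero[OF q1])
qed

lemma continuous_on_aw_phi:
  assumes "continuous_on S a" "continuous_on S b" "continuous_on S c" "continuous_on S d" "continuous_on S z"
    and "\<And>x. x \<in> S \<Longrightarrow> norm (a x) < 1 \<and> norm (b x) < 1 \<and> norm (c x) < 1 \<and> norm (d x) < 1 \<and> norm (z x) = 1"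
  shows "continuous_on S (\<lambda>x. aw_phi q m (a x) (b x) (c x) (d x) (z x))"
proof -
  have "z x \<noteq> 0" if "x \<in> S" for x using assms(6)[OF that] by auto
  with assms q0 show ?thesis
    unfolding aw_phi_def
    by (auto intro!: continuous_intros simp: qpoch_mult_nonzero qpoch_qq_nonzero[OF q1])
qed

lemma continuous_on_aw_total:
  assumes "continuous_on S a" "continuous_on S b" "continuous_on S c" "continuous_on S d"
    and "\<And>x. x \<in> S \<Longrightarrow> norm (a x) < 1 \<and> norm (b x) < 1 \<and> norm (c x) < 1 \<and> norm (d x) < 1"
  shows "continuous_on S (\<lambda>x. aw_total q (a x) (b x) (c x) (d x))"
proof -
  have "qpoch_inf (x * y) q \<noteq> 0" if "norm x < 1" "norm y < 1" for x y
    using that by (intro qpoch_inf_nonzero q1 norm_mult_less_1)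
  moreover have "qpoch_inf q q \<noteq> 0" by (intro qpoch_inf_nonzero q1)
  ultimately show ?thesis
    unfolding aw_total_prod using assms
    by (auto intro!: continuous_intros continuous_on_qpoch_inf[OF q1])
qed

text \<open>Each zero among \<open>b, c, d\<close> is replaced by a small positive \<open>s\<close>. For \<open>s > 0\<close> the generic case
  applies, and both sides are continuous at \<open>s = 0\<close>.\<close>
theorem aw_gf_coeff_integral:
  assumes n: "norm \<alpha> < 1" "norm a < 1" "norm b < 1" "norm c < 1" "norm d < 1" and \<alpha>: "\<alpha> \<noteq> 0"
  shows "((\<lambda>\<theta>. aw_gf_coeff q m a b c d (cis \<theta>) * aw_phi q n \<alpha> b c d (cis \<theta>) * aw_kernel q \<alpha> b c d (cis \<theta>))
     has_integral aw_gf_integral q m n \<alpha> a b c d) {0..pi}"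
proof -
  define r :: "complex \<Rightarrow> real \<Rightarrow> complex" where "r x s = (if x = 0 then of_real s else x)" for x s
  have r0: "r x 0 = x" for x by (simp add: r_def)
  have rn: "norm (r x s) < 1" if "norm x < 1" "s \<in> {0..1/2}" for x s
    using that by (auto simp: r_def)
  have rnz: "r x s \<noteq> 0" if "s \<in> {0<..1/2}" for x s
    using that by (auto simp: r_def)
  have rc [continuous_intros]: "continuous_on S f \<Longrightarrow> continuous_on S (\<lambda>x. r y (f x))"
    for S :: "'t :: topological_space set" and f y
    unfolding r_def by (cases "y = 0") (auto intro!: continuous_intros)
  define H where "H s \<theta> = aw_gf_coeff q m a (r b s) (r c s) (r d s) (cis \<theta>)
     * aw_phi q n \<alpha> (r b s) (r c s) (r d s) (cis \<theta>) * aw_kernel q \<alpha> (r b s) (r c s) (r d s) (cis \<theta>)" for s \<theta>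
  define J where "J s = aw_gf_integral q m n \<alpha> a (r b s) (r c s) (r d s)" for s
  have cH: "continuous_on ({0..1/2} \<times> cbox 0 pi) (\<lambda>(s, \<theta>). H s \<theta>)"
    unfolding H_def case_prod_unfold
    by (intro continuous_on_mult continuous_on_aw_gf_coeff continuous_on_aw_phi continuous_on_aw_kernel[OF q1]
      continuous_intros) (auto simp: rn n)
  have cJ: "continuous_on {0..1/2} J"
  proof (cases "m < n")
    case False
    have "qpoch (\<alpha> * r b s * r c s * r d s) q (n + m) \<noteq> 0" if "s \<in> {0..1/2}" for s
      using that by (intro qpoch_nonzero norm_mult_less_1 rn n q1)
    moreover have "qpoch (a * r b s) q m \<noteq> 0" if "s \<in> {0..1/2}" for s
      using that by (intro qpoch_mult_nonzero rn n)
    ultimately show ?thesis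
      unfolding J_def aw_gf_integral_def using False q0
      by (simp, intro continuous_intros continuous_on_aw_total)
         (auto simp: rn n qpoch_qq_nonzero[OF q1])
  qed (simp add: J_def aw_gf_integral_def)
  have cI: "continuous_on {0..1/2} (\<lambda>s. integral (cbox 0 pi) (H s))"
    by (rule integral_continuous_on_param[OF cH])
  have pos: "integral (cbox 0 pi) (H s) - J s = 0" if "s \<in> {0<..1/2}" for s
  proof -
    have s: "s \<in> {0..1/2}" using that by auto
    have "(H s has_integral J s) {0..pi}"
      unfolding H_def J_def aw_gf_integral_def
      by (intro aw_gf_coeff_integral_generic[OF q1 q0] n rn[OF _ s] rnz[OF that] \<alpha>)
    then show ?thesis by (simp add: integral_unique)
  qed
  have cl: "closure {0<..1/2} = {0..1/2::real}" by simp
  have "integral (cbox 0 pi) (H 0) - J 0 = 0"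
    by (rule continuous_constant_on_closure[where S = "{0<..1/2::real}", unfolded cl, OF continuous_on_diff[OF cI cJ] pos])
      auto
  moreover have "H 0 integrable_on {0..pi}"
    unfolding H_def r0
    by (intro integrable_continuous_real continuous_on_mult continuous_on_aw_gf_coeff continuous_on_aw_phi
       continuous_on_aw_kernel[OF q1] continuous_intros) (auto simp: n)
  ultimately have "(H 0 has_integral J 0) {0..pi}"
    by (simp add: has_integral_integral)
  then show ?thesis unfolding H_def J_def r0 .
qed

lemma norm_qpoch_bounded: "\<exists>C. \<forall>x k. norm x \<le> 1 \<longrightarrow> norm (qpoch x q k) \<le> C"
proof (intro exI allI impI)
  fix x :: complex and k assume x: "norm x \<le> 1"
  have "norm (qpoch x q k) \<le> (\<Prod>j<k. norm (1 - x * q ^ j))"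
    by (simp add: qpoch_def prod_norm)
  also have "\<dots> \<le> (\<Prod>j<k. 1 + norm q ^ j)"
  proof (intro prod_mono conjI norm_ge_zero)
    fix j
    have "norm (1 - x * q ^ j) \<le> 1 + norm x * norm q ^ j"
      using norm_triangle_ineq4[of 1 "x * q ^ j"] by (simp add: norm_mult norm_power)
    also have "\<dots> \<le> 1 + 1 * norm q ^ j" using x by (intro add_left_mono mult_right_mono) auto
    finally show "norm (1 - x * q ^ j) \<le> 1 + norm q ^ j" by simp
  qed
  also have "\<dots> \<le> exp (\<Sum>j<k. norm q ^ j)"
    by (rule prod_le_exp_sum) auto
  also have "\<dots> \<le> exp (\<Sum>j. norm q ^ j)"
    using q1 by (simp add: sum_le_suminf summable_geometric)
  finally show "norm (qpoch x q k) \<le> exp (\<Sum>j. norm q ^ j)" .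
qed

text \<open>The reciprocals converge, because the limit of the symbols is nonzero.\<close>
lemma norm_inverse_qpoch_bounded:
  assumes "norm x < 1"
  shows "\<exists>C. \<forall>k. norm (inverse (qpoch x q k)) \<le> C"
proof -
  have "(\<lambda>k. inverse (qpoch x q k)) \<longlonglongrightarrow> inverse (qpoch_inf x q)"
    by (intro tendsto_inverse qpoch_LIMSEQ q1 qpoch_inf_nonzero assms)
  then show ?thesis
    using convergent_imp_Bseq convergentI Bseq_def by metis
qed

lemma phi21_coeff_bounded:
  assumes "norm a < 1" "norm b < 1"
  shows "\<exists>C. \<forall>z k. norm z = 1 \<longrightarrow>
    norm (qpoch (a * z) q k * qpoch (b * z) q k / (qpoch q q k * qpoch (a * b) q k)) \<le> C"
proof -
  obtain C1 where C1: "norm x \<le> 1 \<Longrightarrow> norm (qpoch x q k) \<le> C1" for x k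
    using norm_qpoch_bounded by auto
  obtain C2 where C2: "norm (inverse (qpoch q q k)) \<le> C2" for k
    using norm_inverse_qpoch_bounded[OF q1] by auto
  obtain C3 where C3: "norm (inverse (qpoch (a * b) q k)) \<le> C3" for k
    using norm_inverse_qpoch_bounded[OF norm_mult_less_1[OF assms]] by auto
  have "norm (qpoch (a * z) q k * qpoch (b * z) q k / (qpoch q q k * qpoch (a * b) q k)) \<le> C1 * C1 * (C2 * C3)"
    if z: "norm z = 1" for z k
  proof -
    have "norm (qpoch (a * z) q k) \<le> C1" "norm (qpoch (b * z) q k) \<le> C1"
      using z assms by (auto intro!: C1 simp: norm_mult)
    moreover have "0 \<le> C1" "0 \<le> C2" "0 \<le> C3"
      using norm_ge_zero order_trans calculation(1) C2 C3 by blast+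
    ultimately show ?thesis
      unfolding divide_inverse inverse_mult_distrib norm_mult
      by (intro mult_mono C2 C3 mult_nonneg_nonneg norm_ge_zero) auto
  qed
  then show ?thesis by auto
qed

end

section \<open>Summing the generating function\<close>

lemma basic_hyp_2_1: "basic_hyp [x, y] [w] q u
    = (\<Sum>k. qpoch x q k * qpoch y q k / (qpoch q q k * qpoch w q k) * u ^ k)"
  by (simp add: basic_hyp_def qpochs_def)

text \<open>The square roots in the statement only enter through their squares, so the choice of branch does
  not matter.\<close>
lemma qpoch_sqrt_pairs:
  assumes q0: "q \<noteq> 0" and s: "s\<^sup>2 = x / q" and r: "r\<^sup>2 = x"
  shows "qpoch s q n * qpoch (- s) q n * qpoch r q n * qpoch (- r) q n = qpoch (x / q) q (n + n)"
proof (induction n)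
  case (Suc n)
  have "(1 - s * q ^ n) * (1 - - s * q ^ n) * (1 - r * q ^ n) * (1 - - r * q ^ n)
     = (1 - s\<^sup>2 * (q ^ n * q ^ n)) * (1 - r\<^sup>2 * (q ^ n * q ^ n))"
    by (simp add: power2_eq_square algebra_simps)
  also have "\<dots> = (1 - x / q * q ^ (n + n)) * (1 - x / q * q ^ Suc (n + n))"
    unfolding s r using q0 by (simp add: power_add)
  finally have e: "(1 - s * q ^ n) * (1 - - s * q ^ n) * (1 - r * q ^ n) * (1 - - r * q ^ n) = \<dots>" .
  have "qpoch s q (Suc n) * qpoch (- s) q (Suc n) * qpoch r q (Suc n) * qpoch (- r) q (Suc n)
     = (qpoch s q n * qpoch (- s) q n * qpoch r q n * qpoch (- r) q n)
       * ((1 - s * q ^ n) * (1 - - s * q ^ n) * (1 - r * q ^ n) * (1 - - r * q ^ n))"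
    by (simp only: qpoch_Suc mult_ac)
  also have "\<dots> = qpoch (x / q) q (Suc n + Suc n)"
    unfolding Suc e add_Suc add_Suc_right qpoch_Suc by (simp only: mult_ac)
  finally show ?case .
qed simp

context
  fixes q :: complex
  assumes q1: "norm q < 1" and q0: "q \<noteq> 0"
begin

text \<open>The first part is the Cauchy product of the two \<open>\<^sub>2\<phi>\<^sub>1\<close> series. The second is a majorant that does
  not depend on \<open>z\<close>, as needed for integrating term by term: since the coefficients of both
  series are bounded uniformly on the circle, the coefficient of \<open>t\<^sup>m\<close> grows at most linearly in \<open>m\<close>.\<close>
lemma aw_gf_sums:
  assumes n: "norm a < 1" "norm b < 1" "norm c < 1" "norm d < 1" and t: "norm t < 1"
  shows "norm z = 1 \<Longrightarrow> (\<lambda>m. t ^ m * aw_gf_coeff q m a b c d z) sums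
      (basic_hyp [a * z, b * z] [a * b] q (t / z) * basic_hyp [c / z, d / z] [c * d] q (t * z))" (is "_ \<Longrightarrow> ?P")
    and "\<exists>M. summable M \<and> (\<forall>m z. norm z = 1 \<longrightarrow> norm (t ^ m * aw_gf_coeff q m a b c d z) \<le> M m)" (is ?Q)
proof -
  define A where "A z i = qpoch (a * z) q i * qpoch (b * z) q i / (qpoch q q i * qpoch (a * b) q i)" for z i
  define B where "B z j = qpoch (c / z) q j * qpoch (d / z) q j / (qpoch q q j * qpoch (c * d) q j)" for z j
  obtain CA where CA: "norm z = 1 \<Longrightarrow> norm (A z k) \<le> CA" for z k
    unfolding A_def using phi21_coeff_bounded[OF q1 q0 n(1,2)] by auto
  obtain CB where CB: "norm z = 1 \<Longrightarrow> norm (B z k) \<le> CB" for z k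
  proof -
    obtain C where C: "\<And>z k. norm z = 1 \<Longrightarrow> norm (qpoch (c * z) q k * qpoch (d * z) q k / (qpoch q q k * qpoch (c * d) q k)) \<le> C"
      using phi21_coeff_bounded[OF q1 q0 n(3,4)] by auto
    have "norm (B z k) \<le> C" if "norm z = 1" for z k
      using C[of "1 / z" k] that by (simp add: B_def norm_divide)
    with that show thesis by blast
  qed
  have nonneg: "0 \<le> CA" "0 \<le> CB"
    using order_trans[OF norm_ge_zero CA[of 1]] order_trans[OF norm_ge_zero CB[of 1]] by simp_all
  have prod: "(\<Sum>i\<le>m. (A z i * (t / z) ^ i) * (B z (m - i) * (t * z) ^ (m - i))) = t ^ m * aw_gf_coeff q m a b c d z"
    for m z
    unfolding aw_gf_coeff_def sum_distrib_left A_def[symmetric] B_def[symmetric]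
  proof (intro sum.cong refl)
    fix i assume "i \<in> {..m}"
    then have "t ^ m = t ^ i * t ^ (m - i)" by (simp flip: power_add)
    then show "A z i * (t / z) ^ i * (B z (m - i) * (t * z) ^ (m - i))
       = t ^ m * (A z i * (1 / z) ^ i * (B z (m - i) * z ^ (m - i)))"
      by (simp add: power_divide power_mult_distrib)
  qed
  show ?P if z: "norm z = 1"
  proof -
    have "norm (t / z) = norm t" "norm (t * z) = norm t" using z by (simp_all add: norm_divide norm_mult)
    then have le: "norm (norm (A z k * (t / z) ^ k)) \<le> CA * norm t ^ k"
      "norm (norm (B z k * (t * z) ^ k)) \<le> CB * norm t ^ k" for k
      using CA[OF z] CB[OF z] z by (simp_all add: norm_mult norm_power mult_right_mono)
    have g: "summable (\<lambda>k. C * norm t ^ k)" for C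
      using t by (intro summable_mult summable_geometric) simp
    have "summable (\<lambda>k. norm (A z k * (t / z) ^ k))" "summable (\<lambda>k. norm (B z k * (t * z) ^ k))"
      by (rule summable_comparison_test'[OF g, of 0] le)+
    from Cauchy_product_sums[OF this, unfolded prod] show ?thesis
      unfolding basic_hyp_2_1 A_def B_def .
  qed
  show ?Q
  proof (intro exI conjI allI impI)
    show "summable (\<lambda>m. CA * CB * (of_nat (Suc m) * norm t ^ m))"
      using geometric_deriv_sums[of "norm t"] t by (intro summable_mult) (auto simp: sums_iff)
    fix m and z :: complex assume z: "norm z = 1"
    have "norm (t ^ m * aw_gf_coeff q m a b c d z) \<le> (\<Sum>i\<le>m. CA * CB * norm t ^ m)"
      unfolding prod[symmetric]
    proof (rule sum_norm_le)
      fix i assume i: "i \<in> {..m}"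
      have "norm t ^ i * norm t ^ (m - i) = norm t ^ m" using i by (simp flip: power_add)
      then have "norm (A z i * (t / z) ^ i * (B z (m - i) * (t * z) ^ (m - i))) = norm (A z i) * norm (B z (m - i)) * norm t ^ m"
        using z by (simp add: norm_mult norm_power norm_divide)
      also have "\<dots> \<le> CA * CB * norm t ^ m"
        using nonneg by (intro mult_mono CA CB z mult_nonneg_nonneg) auto
      finally show "norm (A z i * (t / z) ^ i * (B z (m - i) * (t * z) ^ (m - i))) \<le> CA * CB * norm t ^ m" .
    qed
    then show "norm (t ^ m * aw_gf_coeff q m a b c d z) \<le> CA * CB * (of_nat (Suc m) * norm t ^ m)"
      by (simp add: algebra_simps)
  qed
qed

theorem aw_gf_integral_sums:
  fixes \<alpha> a b c d t :: complex and k :: nat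
  assumes n: "norm \<alpha> < 1" "norm a < 1" "norm b < 1" "norm c < 1" "norm d < 1" and \<alpha>: "\<alpha> \<noteq> 0" and t: "norm t < 1"
  defines "F \<equiv> (\<lambda>\<theta>. basic_hyp [a * cis \<theta>, b * cis \<theta>] [a * b] q (t / cis \<theta>)
      * basic_hyp [c / cis \<theta>, d / cis \<theta>] [c * d] q (t * cis \<theta>)
      * aw_phi q k \<alpha> b c d (cis \<theta>) * aw_kernel q \<alpha> b c d (cis \<theta>))"
  shows "continuous_on {0..pi} F"
    and "(\<lambda>m. t ^ m * aw_gf_integral q m k \<alpha> a b c d) sums integral {0..pi} F"
proof -
  define w where "w \<theta> = aw_phi q k \<alpha> b c d (cis \<theta>) * aw_kernel q \<alpha> b c d (cis \<theta>)" for \<theta>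
  define f where "f m \<theta> = t ^ m * aw_gf_coeff q m a b c d (cis \<theta>) * w \<theta>" for m \<theta>
  have cw: "continuous_on {0..pi} w"
    unfolding w_def using n
    by (intro continuous_on_mult continuous_on_aw_phi[OF q1 q0] continuous_on_aw_kernel[OF q1] continuous_intros) auto
  have cf: "continuous_on {0..pi} (f m)" for m
    unfolding f_def using n
    by (intro continuous_on_mult cw continuous_on_aw_gf_coeff[OF q1 q0] continuous_intros) auto
  obtain L where "\<forall>y\<in>w ` {0..pi}. norm y \<le> L"
    using compact_imp_bounded[OF compact_continuous_image[OF cw compact_Icc]] unfolding bounded_iff by blast
  then have L: "norm (w \<theta>) \<le> L" if "\<theta> \<in> {0..pi}" for \<theta>
    using that by blast
  obtain M where M: "summable M" "\<And>m z. norm z = 1 \<Longrightarrow> norm (t ^ m * aw_gf_coeff q m a b c d z) \<le> M m"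
    using aw_gf_sums(2)[OF n(2-5) t] by blast
  have F: "F \<theta> = (\<Sum>m. f m \<theta>)" for \<theta>
    using sums_mult2[OF aw_gf_sums(1)[OF n(2-5) t, of "cis \<theta>"], of "w \<theta>"]
    unfolding f_def F_def w_def by (simp add: sums_iff mult.assoc)
  have ul: "uniform_limit {0..pi} (\<lambda>N \<theta>. \<Sum>m<N. f m \<theta>) F sequentially"
    unfolding F
  proof (rule Weierstrass_m_test)
    show "summable (\<lambda>m. M m * L)" by (intro summable_mult2 M)
    fix m \<theta> assume "\<theta> \<in> {0..pi}"
    then show "norm (f m \<theta>) \<le> M m * L"
      unfolding f_def norm_mult[of _ "w \<theta>"]
      using order_trans[OF norm_ge_zero M(2)[of "cis \<theta>" m]] by (intro mult_mono M L) auto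
  qed
  have cs: "continuous_on {0..pi} (\<lambda>\<theta>. \<Sum>m<N. f m \<theta>)" for N
    by (intro continuous_on_sum cf)
  show "continuous_on {0..pi} F"
    by (rule uniform_limit_theorem[OF _ ul]) (simp_all add: cs)
  obtain I J where I: "\<And>N. ((\<lambda>\<theta>. \<Sum>m<N. f m \<theta>) has_integral I N) {0..pi}"
    and J: "(F has_integral J) {0..pi}" and IJ: "I \<longlonglongrightarrow> J"
    using uniform_limit_integral[OF ul cs] by auto
  have "((\<lambda>\<theta>. \<Sum>m<N. f m \<theta>) has_integral (\<Sum>m<N. t ^ m * aw_gf_integral q m k \<alpha> a b c d)) {0..pi}" for N
    unfolding f_def w_def
    using has_integral_mult_right[OF aw_gf_coeff_integral[OF q1 q0 n \<alpha>]]
    by (intro has_integral_sum) (simp_all add: mult.assoc)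
  then have "I = (\<lambda>N. \<Sum>m<N. t ^ m * aw_gf_integral q m k \<alpha> a b c d)"
    using I has_integral_unique by blast
  with IJ J show "(\<lambda>m. t ^ m * aw_gf_integral q m k \<alpha> a b c d) sums integral {0..pi} F"
    by (simp add: sums_def integral_unique)
qed

text \<open>
  The terms with \<open>m < n\<close> are zero, and those with \<open>m = n + k\<close> are the terms of the \<open>\<^sub>4\<phi>\<^sub>3\<close> times the
  prefactor. Both \<open>(X/q)\<^sub>n\<^sub>+\<^sub>k (Xq\<^sup>n\<^sup>+\<^sup>k\<^sup>-\<^sup>1)\<^sub>n\<close> and \<open>(X/q)\<^sub>2\<^sub>n (Xq\<^sup>2\<^sup>n\<^sup>-\<^sup>1)\<^sub>k\<close> are \<open>(X/q)\<^sub>2\<^sub>n\<^sub>+\<^sub>k\<close> for \<open>X = abcd\<close>; this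
  is where \<open>X \<noteq> q\<close> enters, through the division by \<open>(X/q)\<^sub>n\<^sub>+\<^sub>k\<close>.
\<close>
lemma aw_gf_integral_series:
  fixes \<alpha> a b c d t :: complex
  assumes nm: "norm \<alpha> < 1" "norm a < 1" "norm b < 1" "norm c < 1" "norm d < 1" and \<alpha>: "\<alpha> \<noteq> 0"
    and abcd: "a * b * c * d \<noteq> q"
    and J: "(\<lambda>m. t ^ m * aw_gf_integral q m n \<alpha> a b c d) sums J"
  shows "qpochs [\<alpha> * b, \<alpha> * c, \<alpha> * d] q n / \<alpha> ^ n * J =
        2 * of_real pi * t ^ n * qpoch_inf (\<alpha> * b * c * d * q ^ (2 * n)) q
        * qpochs [csqrt (a * b * c * d / q), - csqrt (a * b * c * d / q),
                  csqrt (a * b * c * d), - csqrt (a * b * c * d)] q n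
        / (qpochs_inf [q ^ (n + 1), \<alpha> * b * q ^ n, \<alpha> * c * q ^ n, \<alpha> * d * q ^ n,
                       b * c * q ^ n, b * d * q ^ n, c * d * q ^ n] q
           * qpochs [q, a * b, c * d, a * b * c * d / q] q n)
        * basic_hyp [a / \<alpha>, b * c * q ^ n, b * d * q ^ n, a * b * c * d * q powi (2 * int n - 1)]
            [a * b * q ^ n, a * b * c * d * q powi (int n - 1), \<alpha> * b * c * d * q ^ (2 * n)]
            q (\<alpha> * t)" (is "_ = ?PRE * ?H")
proof -
  define X where "X = a * b * c * d"
  define Y where "Y = \<alpha> * b * c * d"
  define u where "u k = qpoch (a / \<alpha>) q k * qpoch (b * c * q ^ n) q k * qpoch (b * d * q ^ n) q k
     * qpoch (X / q * q ^ (n + n)) q k / (qpoch q q k * qpoch (a * b * q ^ n) q k * qpoch (X / q * q ^ n) q k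
       * qpoch (Y * q ^ (n + n)) q k) * (\<alpha> * t) ^ k" for k
  have pw: "X * q powi (2 * int n - 1) = X / q * q ^ (n + n)" "X * q powi (int n - 1) = X / q * q ^ n"
  proof -
    have e: "2 * int n - 1 = int (n + n) - 1" by simp
    have "q powi (int k - 1) = q ^ k / q" for k
      using q0 by (simp add: power_int_diff)
    then show "X * q powi (2 * int n - 1) = X / q * q ^ (n + n)" "X * q powi (int n - 1) = X / q * q ^ n"
      unfolding e by (simp_all only: times_divide_eq_left times_divide_eq_right)
  qed
  have H: "?H = suminf u"
    unfolding basic_hyp_def qpochs_def X_def[symmetric] Y_def[symmetric] pw u_def mult_2[of n]
    by (simp add: mult_ac)
  have nX: "norm X < 1" and nY: "norm Y < 1"
    unfolding X_def Y_def by (intro norm_mult_less_1 nm)+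
  have nzX: "qpoch (X / q) q k \<noteq> 0" for k
  proof (cases k)
    case (Suc j)
    have "1 - X / q \<noteq> 0" using abcd q0 by (simp add: X_def)
    moreover have "qpoch (X / q * q) q j \<noteq> 0" using q0 qpoch_nonzero[OF nX q1] by simp
    ultimately show ?thesis unfolding Suc qpoch_Suc' by simp
  qed simp
  have n': "norm (\<alpha> * b) < 1" "norm (\<alpha> * c) < 1" "norm (\<alpha> * d) < 1" "norm (a * b) < 1"
    "norm (b * c) < 1" "norm (b * d) < 1" "norm (c * d) < 1"
    by (intro norm_mult_less_1 nm)+
  note shift = n'[THEN qpoch_inf_shift[OF q1 q0]] qpoch_inf_shift[OF q1 q0 nY]
  note nz = n'[THEN qpoch_nonzero, OF q1] qpoch_nonzero[OF nY q1] qpoch_qq_nonzero[OF q1] nzX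
  note nzi = n'[THEN qpoch_inf_nonzero[OF q1]] qpoch_inf_nonzero[OF q1 q1]
  have quad: "qpochs [csqrt (X / q), - csqrt (X / q), csqrt X, - csqrt X] q n = qpoch (X / q) q (n + n)"
    using qpoch_sqrt_pairs[OF q0, of "csqrt (X / q)" X "csqrt X" n] by (simp add: qpochs_def mult_ac)
  define D0 where "D0 = qpoch_inf q q * qpoch_inf (\<alpha> * b) q * qpoch_inf (\<alpha> * c) q * qpoch_inf (\<alpha> * d) q
     * qpoch_inf (b * c) q * qpoch_inf (b * d) q * qpoch_inf (c * d) q"
  define R where "R = qpoch (\<alpha> * b) q n * qpoch (\<alpha> * c) q n * qpoch (\<alpha> * d) q n * qpoch (b * c) q n * qpoch (b * d) q n"
  define C where "C = 2 * of_real pi * t ^ n * (qpoch_inf Y q / qpoch Y q (n + n)) * qpoch (X / q) q (n + n)"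
  define E where "E = C * R / (D0 * (qpoch (a * b) q n * qpoch (X / q) q n))"
  have PRE: "?PRE = E"
  proof -
    have "?PRE = C / (qpoch_inf q q / qpoch q q n * (qpoch_inf (\<alpha> * b) q / qpoch (\<alpha> * b) q n
        * (qpoch_inf (\<alpha> * c) q / qpoch (\<alpha> * c) q n * (qpoch_inf (\<alpha> * d) q / qpoch (\<alpha> * d) q n
        * (qpoch_inf (b * c) q / qpoch (b * c) q n * (qpoch_inf (b * d) q / qpoch (b * d) q n
        * (qpoch_inf (c * d) q / qpoch (c * d) q n))))))
        * (qpoch q q n * (qpoch (a * b) q n * (qpoch (c * d) q n * qpoch (X / q) q n))))"
      unfolding X_def[symmetric] Y_def[symmetric] quad
      unfolding qpochs_inf_def qpochs_def list.map power_add[of q n 1]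
        mult_2 power_one_right mult.commute[of "q ^ n" q] shift qpoch_inf_shift[OF q1 q0 q1] C_def
      by simp
    also have "\<dots> = C * (qpoch q q n * qpoch (c * d) q n * R) / (D0 * (qpoch q q n * qpoch (c * d) q n)
        * (qpoch (a * b) q n * qpoch (X / q) q n))"
      unfolding R_def D0_def
      by (simp only: times_divide_eq_left times_divide_eq_right divide_divide_eq_left divide_divide_eq_right mult_ac)
    also have "\<dots> = E"
    proof -
      have "C * (x * R) / (D0 * x * y) = C * R / (D0 * y)" if "x \<noteq> 0" for x y
        using that by simp
      then show ?thesis unfolding E_def using nz by simp
    qed
    finally show ?thesis .
  qed
  define P0 where "P0 = qpochs [\<alpha> * b, \<alpha> * c, \<alpha> * d] q n / \<alpha> ^ n"
  have trm: "P0 * (t ^ (n + k) * aw_gf_integral q (n + k) n \<alpha> a b c d) = E * u k" for k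
  proof -
    have s: "qpoch x q (n + k) = qpoch x q n * qpoch (x * q ^ n) q k" for x
      by (rule qpoch_add)
    have sY: "qpoch Y q (n + (n + k)) = qpoch Y q (n + n) * qpoch (Y * q ^ (n + n)) q k"
      by (simp only: add.assoc[symmetric] qpoch_add)
    have "qpoch (X / q) q (n + k) * qpoch (X / q * q ^ (n + k)) q n
        = qpoch (X / q) q (n + n) * qpoch (X / q * q ^ (n + n)) q k"
      by (simp only: qpoch_add[symmetric] add_ac)
    then have sX: "qpoch (X * q ^ (n + k) / q) q n
        = qpoch (X / q) q (n + n) * qpoch (X / q * q ^ (n + n)) q k / (qpoch (X / q) q n * qpoch (X / q * q ^ n) q k)"
      using nzX[of "n + k"] unfolding s[of "X / q", symmetric]
      by (subst nonzero_eq_divide_eq) (simp_all add: mult.commute)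
    have "P0 * (t ^ (n + k) * aw_gf_integral q (n + k) n \<alpha> a b c d)
       = qpoch (\<alpha> * b) q n * qpoch (\<alpha> * c) q n * qpoch (\<alpha> * d) q n * (t ^ n * t ^ k *
       (2 * of_real pi * qpoch_inf Y q
   / (qpoch_inf q q * (qpoch_inf (\<alpha> * b) q * (qpoch_inf (\<alpha> * c) q * (qpoch_inf (\<alpha> * d) q
      * (qpoch_inf (b * c) q * (qpoch_inf (b * d) q * qpoch_inf (c * d) q)))))) *
      (qpoch (b * c) q (n + k) * qpoch (b * d) q (n + k) * qpoch (X * q ^ (n + k) / q) q n
          * (\<alpha> ^ k * qpoch (a / \<alpha>) q k))
         / (qpoch q q k * qpoch (a * b) q (n + k) * qpoch Y q (n + (n + k)))))"
      unfolding aw_gf_integral_def aw_total_prod P0_def X_def[symmetric] Y_def[symmetric]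
      using \<alpha> by (simp add: qpochs_def power_add)
    also have "\<dots> = E * u k"
      unfolding sX sY s[of "b * c"] s[of "b * d"] s[of "a * b"] E_def u_def C_def R_def D0_def power_mult_distrib
      by (simp only: times_divide_eq_left times_divide_eq_right divide_divide_eq_left divide_divide_eq_right mult_ac)
    finally show ?thesis .
  qed
  have "(\<lambda>k. t ^ (k + n) * aw_gf_integral q (k + n) n \<alpha> a b c d) sums J"
    using J by (subst sums_zero_iff_shift) (simp_all add: aw_gf_integral_def)
  then have "(\<lambda>k. P0 * (t ^ (n + k) * aw_gf_integral q (n + k) n \<alpha> a b c d)) sums (P0 * J)"
    by (intro sums_mult) (simp add: add.commute)
  then have sm: "(\<lambda>k. E * u k) sums (P0 * J)" unfolding trm .
  have "P0 * J = E * suminf u"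
  proof (cases "E = 0")
    case True
    then show ?thesis using sums_unique2[OF sm, of 0] by simp
  next
    case False
    from sums_unique[OF sums_mult_D[OF sm this]] False show ?thesis by (simp add: field_simps)
  qed
  then show ?thesis unfolding PRE H P0_def .
qed

end

section \<open>The integral over the interval\<close>

text \<open>The substitution \<open>x = cos \<theta>\<close>. The weight is unbounded at the endpoints, so the integral is obtained
  from the primitive of \<open>F\<close> composed with \<open>arccos\<close>, which is continuous on the closed interval
  and differentiable inside.\<close>
lemma has_integral_arccos_substitution:
  fixes F :: "real \<Rightarrow> complex"
  assumes cont: "continuous_on {0..pi} F" and I: "(F has_integral I) {0..pi}"
  shows "((\<lambda>x. F (arccos x) * of_real (1 / sqrt (1 - x\<^sup>2))) has_integral I) {-1..1}"
proof -
  define P where "P \<theta> = integral {0..\<theta>} F" for \<theta>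
  have cP: "continuous_on {0..pi} P"
    unfolding P_def by (intro indefinite_integral_continuous_1 integrable_continuous_real cont)
  have "((\<lambda>x. F (arccos x) * of_real (1 / sqrt (1 - x\<^sup>2))) has_integral - P (arccos 1) - - P (arccos (-1))) {-1..1}"
  proof (rule fundamental_theorem_of_calculus_interior)
    show "continuous_on {-1..1} (\<lambda>x. - P (arccos x))"
      by (intro continuous_intros continuous_on_compose2[OF cP]) (auto simp: arccos_lbound arccos_ubound)
    fix x :: real assume x: "x \<in> {-1<..<1}"
    then have a: "0 < arccos x" "arccos x < pi" using arccos_lt_bounded[of x] by auto
    have "(P has_vector_derivative F (arccos x)) (at (arccos x) within {0..pi})"
      unfolding P_def using a by (intro integral_has_vector_derivative cont) auto
    then have "(P has_vector_derivative F (arccos x)) (at (arccos x))"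
      using a by (simp add: at_within_Icc_at)
    moreover have "(arccos has_vector_derivative inverse (- sqrt (1 - x\<^sup>2))) (at x)"
      using DERIV_arccos[of x] x by (simp add: has_real_derivative_iff_has_vector_derivative)
    ultimately have "((P \<circ> arccos) has_vector_derivative inverse (- sqrt (1 - x\<^sup>2)) *\<^sub>R F (arccos x)) (at x)"
      by (intro vector_diff_chain_at)
    then have "((\<lambda>x. - P (arccos x)) has_vector_derivative - (inverse (- sqrt (1 - x\<^sup>2)) *\<^sub>R F (arccos x))) (at x)"
      unfolding o_def by (rule has_vector_derivative_minus)
    then show "((\<lambda>x. - P (arccos x)) has_vector_derivative F (arccos x) * of_real (1 / sqrt (1 - x\<^sup>2))) (at x)"
      by (simp add: scaleR_conv_of_real divide_inverse mult.commute)
  qed simp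
  then show ?thesis
    using integral_unique[OF I] by (simp add: P_def)
qed

lemma cnj_qpoch_inf:
  assumes "norm q < 1"
  shows "cnj (qpoch_inf a q) = qpoch_inf (cnj a) (cnj q)"
proof (rule LIMSEQ_unique)
  show "(\<lambda>n. qpoch (cnj a) (cnj q) n) \<longlonglongrightarrow> cnj (qpoch_inf a q)"
    using tendsto_cnj[OF qpoch_LIMSEQ[OF assms, of a]] by (simp add: qpoch_def)
  show "(\<lambda>n. qpoch (cnj a) (cnj q) n) \<longlonglongrightarrow> qpoch_inf (cnj a) (cnj q)"
    using assms by (intro qpoch_LIMSEQ) simp
qed

text \<open>The squared modulus is the product with the conjugate. Conjugation inverts \<open>z\<close> and permutes the
  parameters.\<close>
lemma askey_wilson_weight_conv_aw_kernel:
  fixes q :: real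
  assumes M: "real_or_conj_pairs {#a, b, c, d#}" and q1: "\<bar>q\<bar> < 1"
  shows "complex_of_real (askey_wilson_weight x a b c d q) = aw_kernel q a b c d (cis (arccos x))"
proof -
  define z where "z = cis (arccos x)"
  have q1': "norm (complex_of_real q) < 1" using q1 by simp
  have z: "norm z = 1" "cnj z = 1 / z" "cis (2 * arccos x) = z\<^sup>2"
    by (simp_all add: z_def divide_inverse cis_cnj power2_eq_square cis_mult)
  have conj: "cnj (qpoch_inf (y * z) q) = qpoch_inf (cnj y / z) q" for y
    using cnj_qpoch_inf[OF q1', of "y * z"] z by simp
  have num: "cnj (qpoch_inf (z\<^sup>2) q) = qpoch_inf (1 / z\<^sup>2) q"
    using cnj_qpoch_inf[OF q1', of "z\<^sup>2"] z by (simp add: power_one_over)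
  have "(\<Prod>y\<in>#image_mset cnj {#a, b, c, d#}. qpoch_inf (y / z) q) = (\<Prod>y\<in>#{#a, b, c, d#}. qpoch_inf (y / z) q)"
    using M by (simp add: real_or_conj_pairs_def)
  then have den: "(\<Prod>y\<leftarrow>[a, b, c, d]. qpoch_inf (cnj y / z) q) = (\<Prod>y\<leftarrow>[a, b, c, d]. qpoch_inf (y / z) q)"
    by (simp add: mult_ac)
  have "complex_of_real (askey_wilson_weight x a b c d q)
     = qpoch_inf (z\<^sup>2) q / qpochs_inf [a * z, b * z, c * z, d * z] q
       * cnj (qpoch_inf (z\<^sup>2) q / qpochs_inf [a * z, b * z, c * z, d * z] q)"
    unfolding askey_wilson_weight_def Let_def z_def[symmetric] z(3) complex_norm_square ..
  also have "cnj (qpoch_inf (z\<^sup>2) q / qpochs_inf [a * z, b * z, c * z, d * z] q)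
     = qpoch_inf (1 / z\<^sup>2) q / (\<Prod>y\<leftarrow>[a, b, c, d]. qpoch_inf (y / z) q)"
    unfolding complex_cnj_divide num den[symmetric] by (simp add: qpochs_inf_def conj del: complex_cnj_mult) (simp add: conj)
  finally show ?thesis
    unfolding z_def[symmetric] by (simp add: aw_kernel_def qpochs_inf_def mult_ac)
qed

lemma askey_wilson_poly_conv_aw_phi:
  assumes "q \<noteq> 0"
  shows "askey_wilson_poly n x a b c d q
    = qpochs [a * b, a * c, a * d] q n / a ^ n * aw_phi q n a b c d (cis (arccos x))"
proof -
  define z where "z = cis (arccos x)"
  have z: "y * cis (- arccos x) = y / z" for y by (simp add: z_def divide_inverse)
  define u where "u k = qpoch (1 / q ^ n) q k * qpoch (a * b * c * d * q ^ n / q) q k * q ^ k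
      / (qpoch q q k * qpoch (a * b) q k * qpoch (a * c) q k * qpoch (a * d) q k)
      * (qpoch (a * z) q k * qpoch (a / z) q k)" for k
  have pw: "a * b * c * d * q powi (int n - 1) = a * b * c * d * q ^ n / q" "q powi (- int n) = 1 / q ^ n"
    "a powi (- int n) = 1 / a ^ n"
    using assms by (simp_all add: power_int_diff power_int_minus divide_inverse)
  have u0: "u k = 0" if "k \<notin> {..n}" for k
  proof -
    have "qpoch (1 / q ^ n) q k = 0"
      using that assms by (auto simp: qpoch_def intro!: bexI[of _ n])
    then show ?thesis by (simp add: u_def)
  qed
  have "basic_hyp [1 / q ^ n, a * b * c * d * q ^ n / q, a * z, a / z] [a * b, a * c, a * d] q q = suminf u"
    unfolding basic_hyp_def qpochs_def u_def by (simp add: mult_ac)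
  also have "\<dots> = aw_phi q n a b c d z"
    unfolding aw_phi_def u_def[symmetric] by (rule suminf_finite) (simp_all add: u0)
  finally show ?thesis
    unfolding askey_wilson_poly_def Let_def z pw z_def[symmetric] by simp
qed

theorem corollary28:
  fixes n :: nat and \<alpha> a b c d t :: complex and q :: real
  assumes "\<forall>z\<in>{\<alpha>, a, b, c, d}. z \<in> \<real> \<or> cnj z \<in> {\<alpha>, a, b, c, d}"
    and "real_or_conj_pairs {#\<alpha>, b, c, d#}"
    and "Max {cmod \<alpha>, cmod a, cmod b, cmod c, cmod d} < 1"
    and "0 < \<bar>q\<bar>" and "\<bar>q\<bar> < 1"
    and "cmod t < (1 - q) ^ 3" and "cmod t < 1"
    and "\<alpha> \<noteq> 0" and "a * b * c * d \<noteq> complex_of_real q"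
  shows
    "((\<lambda>x. let \<theta> = arccos x in
         basic_hyp [a * cis \<theta>, b * cis \<theta>] [a * b] q (t * cis (- \<theta>))
         * basic_hyp [c * cis (- \<theta>), d * cis (- \<theta>)] [c * d] q (t * cis \<theta>)
         * askey_wilson_poly n x \<alpha> b c d q
         * (askey_wilson_weight x \<alpha> b c d q / sqrt (1 - x\<^sup>2)))
      has_integral
        2 * pi * t ^ n * qpoch_inf (\<alpha> * b * c * d * q ^ (2 * n)) q
        * qpochs [csqrt (a * b * c * d / q), - csqrt (a * b * c * d / q),
                  csqrt (a * b * c * d), - csqrt (a * b * c * d)] q n
        / (qpochs_inf [q ^ (n + 1), \<alpha> * b * q ^ n, \<alpha> * c * q ^ n, \<alpha> * d * q ^ n,
                       b * c * q ^ n, b * d * q ^ n, c * d * q ^ n] q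
           * qpochs [q, a * b, c * d, a * b * c * d / q] q n)
        * basic_hyp [a / \<alpha>, b * c * q ^ n, b * d * q ^ n, a * b * c * d * q powi (2 * int n - 1)]
            [a * b * q ^ n, a * b * c * d * q powi (int n - 1), \<alpha> * b * c * d * q ^ (2 * n)]
            q (\<alpha> * t))
      {-1..1}"
proof -
  define p :: complex where "p = of_real q"
  have p1: "norm p < 1" and p0: "p \<noteq> 0" using assms(4,5) by (auto simp: p_def)
  have nm: "norm \<alpha> < 1" "norm a < 1" "norm b < 1" "norm c < 1" "norm d < 1" using assms(3) by auto
  define F where "F \<theta> = basic_hyp [a * cis \<theta>, b * cis \<theta>] [a * b] p (t / cis \<theta>)
      * basic_hyp [c / cis \<theta>, d / cis \<theta>] [c * d] p (t * cis \<theta>)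
      * aw_phi p n \<alpha> b c d (cis \<theta>) * aw_kernel p \<alpha> b c d (cis \<theta>)" for \<theta>
  define P where "P = qpochs [\<alpha> * b, \<alpha> * c, \<alpha> * d] p n / \<alpha> ^ n"
  have cont: "continuous_on {0..pi} F"
    and sums: "(\<lambda>m. t ^ m * aw_gf_integral p m n \<alpha> a b c d) sums integral {0..pi} F"
    unfolding F_def by (rule aw_gf_integral_sums[OF p1 p0 nm assms(8,7)])+
  have "((\<lambda>x. P * (F (arccos x) * of_real (1 / sqrt (1 - x\<^sup>2)))) has_integral P * integral {0..pi} F) {-1..1}"
    by (intro has_integral_mult_right has_integral_arccos_substitution cont integrable_integral integrable_continuous_real)
  note I = this[unfolded P_def aw_gf_integral_series[OF p1 p0 nm assms(8,9)[folded p_def] sums]]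
  show ?thesis
    unfolding Let_def of_real_divide askey_wilson_weight_conv_aw_kernel[OF assms(2,5)]
      askey_wilson_poly_conv_aw_phi[OF p0[unfolded p_def]]
    using I by (simp add: F_def p_def divide_inverse mult_ac)
qed

end
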